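(* Let $f$ be an analytic function in the unit disc $\mathbb D$ such that: (a) $f\in\mathcal N_+$, i.e. $$\log|f(z)|\le \int_{\mathbb T} \log|f(\zeta)| \,\mathrm{Re} \left(\frac{\zeta+z}{\zeta-z}\right) dm(\zeta)\quad \text{for all } z\in\mathbb D;$$ (b) $\mathrm{Re} f\in L^1(\mathbb T)$ and $f(0)\in\mathbb R$; (c) $\displaystyle \liminf_{R\to\infty} R\int_R^\infty \frac{m_f(t)}{t}\, dt < \infty.$ Then there exists a finite real Borel measure $\mu$ on $\mathbb T$ such that $$f(z)=\int_{\mathbb T}\frac{\zeta+z}{\zeta-z}\,d\mu(\zeta),\qquad z\in\mathbb D,$$ and $$\|\mu\| \le \|\mathrm{Re} f\|_{L^1(\mathbb T)} + C \liminf_{R\to\infty} R\int_R^\infty \frac{m_f(t)}{t}\, dt,$$ where $C$ is a positive numerical constant (independent of $f$) and $\|\mu\|$ is the total variation of $\mu$.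
   Context: $\mathbb D$ is the open unit disc, $\mathbb T$ the unit circle, and $m$ the normalized Lebesgue measure on $\mathbb T$ ($m(\mathbb T)=1$). For an analytic function $f$ on $\mathbb D$ with non-tangential boundary values a.e. on $\mathbb T$, the same letter $f$ denotes these boundary values (in particular $\mathrm{Re} f$ on $\mathbb T$ denotes the real part of the boundary values), and $m_f(t)=m\{\zeta\in\mathbb T : |f(\zeta)|\ge t\}$ for $t>0$. $\|\cdot\|_{L^1(\mathbb T)}$ is taken with respect to $m$. *)

theory Defs
  imports "HOL-Probability.Probability"
begin

definition circle_measure :: "complex measure" where
  "circle_measure = distr (uniform_measure lborel {0..2*pi})
                          (restrict_space borel (sphere 0 1)) cis"

definition stolz :: "real \<Rightarrow> complex \<Rightarrow> complex set" where
  "stolz \<alpha> \<zeta> = {z. norm z < 1 \<and> norm (\<zeta> - z) < \<alpha> * (1 - norm z)}"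

definition nontangential_limit ::
  "(complex \<Rightarrow> complex) \<Rightarrow> complex \<Rightarrow> complex \<Rightarrow> bool" where
  "nontangential_limit f \<zeta> L \<longleftrightarrow> (\<forall>\<alpha>>1. (f \<longlongrightarrow> L) (at \<zeta> within stolz \<alpha> \<zeta>))"

definition poisson :: "complex \<Rightarrow> complex \<Rightarrow> real" where
  "poisson z \<zeta> = Re ((\<zeta> + z) / (\<zeta> - z))"

text \<open>Positive and negative parts of log x for x \<ge> 0, with log 0 = -infinity.\<close>
definition log_plus :: "real \<Rightarrow> ennreal" where
  "log_plus x = (if x = 0 then 0 else ennreal (max 0 (ln x)))"
definition log_minus :: "real \<Rightarrow> ennreal" where
  "log_minus x = (if x = 0 then \<infinity> else ennreal (max 0 (- ln x)))"

definition log_poisson_integral :: "(complex \<Rightarrow> complex) \<Rightarrow> complex \<Rightarrow> ereal" where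
  "log_poisson_integral g z =
     enn2ereal (\<integral>\<^sup>+ \<zeta>. log_plus (cmod (g \<zeta>)) * ennreal (poisson z \<zeta>) \<partial>circle_measure)
   - enn2ereal (\<integral>\<^sup>+ \<zeta>. log_minus (cmod (g \<zeta>)) * ennreal (poisson z \<zeta>) \<partial>circle_measure)"

text \<open>Condition (a): f in the Smirnov class N+ (with boundary function g).
At zeros of f the left side is -infinity, so the inequality is trivially true.\<close>
definition smirnov :: "(complex \<Rightarrow> complex) \<Rightarrow> (complex \<Rightarrow> complex) \<Rightarrow> bool" where
  "smirnov f g \<longleftrightarrow> (\<forall>z\<in>ball 0 1. f z \<noteq> 0 \<longrightarrow> ereal (ln (cmod (f z))) \<le> log_poisson_integral g z)"

definition distrib_fun :: "(complex \<Rightarrow> complex) \<Rightarrow> real \<Rightarrow> real" where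
  "distrib_fun g t = measure circle_measure {\<zeta>\<in>space circle_measure. cmod (g \<zeta>) \<ge> t}"

definition tail_liminf :: "(complex \<Rightarrow> complex) \<Rightarrow> ennreal" where
  "tail_liminf g = Liminf at_top
     (\<lambda>R::real. ennreal R * (\<integral>\<^sup>+ t\<in>{R..}. ennreal (distrib_fun g t / t) \<partial>lborel))"

end

theory Submission
  imports Defs "HOL-Complex_Analysis.Complex_Analysis"
begin

text \<open>
  For \<open>R > 0\<close> let \<open>\<Phi>\<^sub>R(w) = |Re w|\<close> for \<open>|w| \<le> R\<close> and
  \<open>\<Phi>\<^sub>R(w) = |Re (R\<^sup>2/w)| + 3R log (|w|/R)\<close> for \<open>|w| \<ge> R\<close>. This function is subharmonic, grows only
  logarithmically, and satisfies \<open>\<Phi>\<^sub>R(w) \<le> |Re w| + 3R log\<^sup>+(|w|/R)\<close>. The Smirnov condition shows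
  that the circle means of \<open>log\<^sup>+|f|\<close> are bounded by the mean of its boundary values, so Fatou's
  lemma applied to \<open>R + 3R log\<^sup>+|f| - \<Phi>\<^sub>R(f)\<close> bounds the circle means of \<open>\<Phi>\<^sub>R(f)\<close> by the mean of
  its boundary values. For fixed \<open>r < 1\<close> and \<open>R\<close> large, \<open>\<Phi>\<^sub>R(f) = |Re f|\<close> on the circle of radius
  \<open>r\<close>; since \<open>\<integral>\<^sub>R\<^sup>\<infinity> m\<^sub>f(t)/t dt\<close> is the mean of \<open>log\<^sup>+(|f|/R)\<close>, the \<open>L\<^sup>1\<close> means of \<open>Re f\<close> are at most
  \<open>\<parallel>Re f\<parallel>\<^sub>1 + 3 liminf\<close>. A weak limit of the measures \<open>Re f(r\<zeta>) dm\<close> then represents \<open>f\<close> by the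
  Schwarz integral formula.
\<close>

section \<open>Integration on the unit circle\<close>

lemma space_circle_measure [simp]: "space circle_measure = sphere 0 1"
  by (simp add: circle_measure_def space_restrict_space)

lemma sets_circle_measure [measurable_cong]:
  "sets circle_measure = sets (restrict_space borel (sphere 0 1))"
  by (simp add: circle_measure_def)

lemma cis_measurable_sphere [measurable]:
  "cis \<in> M \<rightarrow>\<^sub>M restrict_space borel (sphere 0 1)" if "sets M = sets borel"
proof -
  have "cis \<in> borel \<rightarrow>\<^sub>M restrict_space borel (sphere 0 1)"
    by (intro measurable_restrict_space2 borel_measurable_continuous_onI) (auto intro: continuous_intros)
  then show ?thesis
    using that by (simp cong: measurable_cong_sets)
qed

lemma prob_space_circle_measure: "prob_space circle_measure"
  unfolding circle_measure_def
  by (intro prob_space.prob_space_distr prob_space_uniform_measure cis_measurable_sphere) auto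

interpretation circle: prob_space circle_measure
  by (rule prob_space_circle_measure)

lemma measure_circle_measure_sphere [simp]: "measure circle_measure (sphere 0 1) = 1"
  using circle.prob_space by simp

lemma borel_measurable_circle_continuous:
  fixes \<phi> :: "complex \<Rightarrow> 'a::{second_countable_topology, topological_space}"
  assumes "continuous_on (sphere 0 1) \<phi>"
  shows "\<phi> \<in> borel_measurable circle_measure"
  using borel_measurable_continuous_on_restrict[OF assms]
  by (simp cong: measurable_cong_sets add: sets_circle_measure)

lemma integrable_circle_continuous:
  fixes \<phi> :: "complex \<Rightarrow> 'a::{banach, second_countable_topology}"
  assumes "continuous_on (sphere 0 1) \<phi>"
  shows "integrable circle_measure \<phi>"
proof -
  have "bounded (\<phi> ` sphere 0 1)"
    by (intro compact_imp_bounded compact_continuous_image assms) auto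
  then obtain B where "\<And>x. x \<in> sphere 0 1 \<Longrightarrow> norm (\<phi> x) \<le> B"
    unfolding bounded_iff by blast
  then show ?thesis
    by (intro circle.integrable_const_bound[where B = B] borel_measurable_circle_continuous assms)
       (auto intro!: AE_I2)
qed

lemma integral_circle_measure:
  fixes \<phi> :: "complex \<Rightarrow> 'a::{banach, second_countable_topology}"
  assumes "\<phi> \<in> borel_measurable circle_measure"
  shows "(\<integral>\<zeta>. \<phi> \<zeta> \<partial>circle_measure) = (\<integral>t. (indicator {0..2*pi} t / (2*pi)) *\<^sub>R \<phi> (cis t) \<partial>lborel)"
    (is ?eq)
    and "integrable circle_measure \<phi> \<longleftrightarrow> integrable lborel (\<lambda>t. (indicator {0..2*pi} t / (2*pi)) *\<^sub>R \<phi> (cis t))"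
    (is ?int)
proof -
  have m: "\<phi> \<in> borel_measurable (restrict_space borel (sphere 0 1))"
    using assms by (simp cong: measurable_cong_sets add: sets_circle_measure)
  have m2 [measurable]: "(\<lambda>t. \<phi> (cis t)) \<in> borel_measurable lborel"
    using measurable_compose[OF cis_measurable_sphere m, of lborel] by simp
  have u: "uniform_measure lborel {0..2*pi} = density lborel (\<lambda>t. ennreal (indicator {0..2*pi} t / (2*pi)))"
    unfolding uniform_measure_def
    by (intro density_cong) (auto split: split_indicator simp: divide_ennreal simp flip: ennreal_1)
  show ?eq
    unfolding circle_measure_def u using m
    by (subst integral_distr) (auto intro!: cis_measurable_sphere integral_density)
  show ?int
    unfolding circle_measure_def u using m
    by (subst integrable_distr_eq)
       (auto intro!: cis_measurable_sphere integrable_density[THEN iffD1] integrable_density[THEN iffD2])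
qed

section \<open>Cauchy and Schwarz formulas for the normalized measure\<close>

lemma has_integral_circle_measure:
  fixes \<phi> :: "complex \<Rightarrow> 'a::euclidean_space"
  assumes "continuous_on (sphere 0 1) \<phi>"
  shows "((\<lambda>t. \<phi> (cis t)) has_integral (2*pi) *\<^sub>R (\<integral>\<zeta>. \<phi> \<zeta> \<partial>circle_measure)) {0..2*pi}"
proof -
  have m: "\<phi> \<in> borel_measurable circle_measure"
    by (rule borel_measurable_circle_continuous[OF assms])
  have "set_integrable lborel {0..2*pi} (\<lambda>t. \<phi> (cis t))"
    by (intro borel_integrable_atLeastAtMost' continuous_on_compose2[OF assms])
       (auto intro: continuous_intros)
  then have "((\<lambda>t. \<phi> (cis t)) has_integral (LINT t:{0..2*pi}|lborel. \<phi> (cis t))) {0..2*pi}"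
    using set_borel_integral_eq_integral integrable_integral by metis
  moreover have "(LINT t:{0..2*pi}|lborel. \<phi> (cis t)) = (2*pi) *\<^sub>R (\<integral>\<zeta>. \<phi> \<zeta> \<partial>circle_measure)"
    by (subst integral_circle_measure(1)[OF m])
       (simp add: set_lebesgue_integral_def flip: integral_scaleR_right)
  ultimately show ?thesis by simp
qed

text \<open>On the unit circle \<open>d\<zeta> = \<i> * \<zeta> dt\<close>, so passing from the
  contour integral to the normalized measure puts the factor \<zeta> into the numerator and cancels
  \<open>2 * pi * \<i>\<close>.\<close>

lemma circle_Cauchy_integral:
  assumes "continuous_on (cball 0 1) F" "F holomorphic_on ball 0 1" "norm z < 1"
  shows "(\<integral>\<zeta>. F \<zeta> * \<zeta> / (\<zeta> - z) \<partial>circle_measure) = F z"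
proof -
  have c: "continuous_on (sphere 0 1) (\<lambda>\<zeta>. F \<zeta> * \<zeta> / (\<zeta> - z))"
    using assms(3) by (intro continuous_intros continuous_on_subset[OF assms(1)]) auto
  have "((\<lambda>u. F u / (u - z)) has_contour_integral (2 * of_real pi * \<i> * F z)) (part_circlepath 0 1 0 (2*pi))"
    using Cauchy_integral_circlepath[OF assms(1,2), of z] assms(3) by (simp add: circlepath_def)
  then have "((\<lambda>t. \<i> * (F (cis t) * cis t / (cis t - z))) has_integral (2 * of_real pi * \<i> * F z)) {0..2*pi}"
    by (subst (asm) has_contour_integral_part_circlepath_iff) (auto simp: mult_ac)
  moreover have "((\<lambda>t. \<i> * (F (cis t) * cis t / (cis t - z))) has_integral
      \<i> * ((2*pi) *\<^sub>R (\<integral>\<zeta>. F \<zeta> * \<zeta> / (\<zeta> - z) \<partial>circle_measure))) {0..2*pi}"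
    by (intro has_integral_mult_right has_integral_circle_measure[OF c])
  ultimately have "2 * of_real pi * \<i> * F z = \<i> * ((2*pi) *\<^sub>R (\<integral>\<zeta>. F \<zeta> * \<zeta> / (\<zeta> - z) \<partial>circle_measure))"
    by (rule has_integral_unique)
  then show ?thesis
    by (simp add: scaleR_conv_of_real)
qed

lemma circle_mean_value:
  assumes "continuous_on (cball 0 1) F" "F holomorphic_on ball 0 1"
  shows "(\<integral>\<zeta>. F \<zeta> \<partial>circle_measure) = F 0"
proof -
  have "(\<integral>\<zeta>. F \<zeta> \<partial>circle_measure) = (\<integral>\<zeta>. F \<zeta> * \<zeta> / (\<zeta> - 0) \<partial>circle_measure)"
    by (intro Bochner_Integration.integral_cong) auto
  then show ?thesis
    using circle_Cauchy_integral[OF assms, of 0] by simp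
qed

text \<open>Write \<open>Re F\<close> as half of \<open>F + cnj F\<close>. Since the kernel is
  \<open>2 * \<zeta> / (\<zeta> - z) - 1\<close>, the first half is given by Cauchy's formula and
  the mean value property. On the circle \<open>cnj \<zeta>\<close> is the inverse of \<zeta>, so
  the second integrand is the conjugate of
  \<open>F \<zeta> * (1 + cnj z * \<zeta>) / (1 - cnj z * \<zeta>)\<close>, which is holomorphic in
  the disc; its mean is its value at 0.\<close>

lemma Schwarz_integral_formula:
  assumes F: "continuous_on (cball 0 1) F" "F holomorphic_on ball 0 1" and z: "norm z < 1"
  shows "(\<integral>\<zeta>. complex_of_real (Re (F \<zeta>)) * ((\<zeta> + z) / (\<zeta> - z)) \<partial>circle_measure) = F z - \<i> * Im (F 0)"
proof -
  have Fs: "continuous_on (sphere 0 1) F"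
    by (rule continuous_on_subset[OF F(1)]) auto
  have ne: "\<zeta> \<noteq> z" if "\<zeta> \<in> sphere 0 1" for \<zeta>
    using z that by auto
  have K: "continuous_on (sphere 0 1) (\<lambda>\<zeta>. (\<zeta> + z) / (\<zeta> - z))"
    using ne by (intro continuous_intros) auto
  have A: "(\<integral>\<zeta>. F \<zeta> * ((\<zeta> + z) / (\<zeta> - z)) \<partial>circle_measure) = 2 * F z - F 0"
  proof -
    have "(\<integral>\<zeta>. F \<zeta> * ((\<zeta> + z) / (\<zeta> - z)) \<partial>circle_measure)
        = (\<integral>\<zeta>. F \<zeta> * \<zeta> / (\<zeta> - z) * 2 - F \<zeta> \<partial>circle_measure)"
      using ne by (intro Bochner_Integration.integral_cong) (auto simp: field_simps)
    also have "\<dots> = (\<integral>\<zeta>. F \<zeta> * \<zeta> / (\<zeta> - z) \<partial>circle_measure) * 2 - (\<integral>\<zeta>. F \<zeta> \<partial>circle_measure)"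
      using ne unfolding integral_mult_left_zero[symmetric]
      by (intro Bochner_Integration.integral_diff)
         (auto intro!: integrable_circle_continuous continuous_intros Fs)
    finally show ?thesis
      by (simp add: circle_Cauchy_integral[OF F z] circle_mean_value[OF F])
  qed
  have B: "(\<integral>\<zeta>. cnj (F \<zeta>) * ((\<zeta> + z) / (\<zeta> - z)) \<partial>circle_measure) = cnj (F 0)"
  proof -
    have nz: "1 - cnj z * \<zeta> \<noteq> 0" if "\<zeta> \<in> cball 0 1" for \<zeta>
    proof
      assume "1 - cnj z * \<zeta> = 0"
      then have "norm (cnj z * \<zeta>) = 1" by simp
      moreover have "norm (cnj z * \<zeta>) \<le> norm z * 1"
        using that unfolding norm_mult by (intro mult_mono) auto
      ultimately show False using z by simp
    qed
    have "(\<integral>\<zeta>. cnj (F \<zeta>) * ((\<zeta> + z) / (\<zeta> - z)) \<partial>circle_measure)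
       = (\<integral>\<zeta>. cnj (F \<zeta> * ((1 + cnj z * \<zeta>) / (1 - cnj z * \<zeta>))) \<partial>circle_measure)"
    proof (intro Bochner_Integration.integral_cong refl)
      fix \<zeta> assume "\<zeta> \<in> space circle_measure"
      then have \<zeta>: "norm \<zeta> = 1" by simp
      then have "\<zeta> * cnj \<zeta> = 1" using complex_norm_square[of \<zeta>] by simp
      then have "(\<zeta> + z) = \<zeta> * (1 + z * cnj \<zeta>)" "(\<zeta> - z) = \<zeta> * (1 - z * cnj \<zeta>)"
        by algebra+
      moreover have "\<zeta> \<noteq> 0" using \<zeta> by auto
      ultimately show "cnj (F \<zeta>) * ((\<zeta> + z) / (\<zeta> - z)) = cnj (F \<zeta> * ((1 + cnj z * \<zeta>) / (1 - cnj z * \<zeta>)))"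
        by simp
    qed
    also have "\<dots> = cnj (\<integral>\<zeta>. F \<zeta> * ((1 + cnj z * \<zeta>) / (1 - cnj z * \<zeta>)) \<partial>circle_measure)"
      by (rule Bochner_Integration.integral_cnj)
    also have "(\<integral>\<zeta>. F \<zeta> * ((1 + cnj z * \<zeta>) / (1 - cnj z * \<zeta>)) \<partial>circle_measure) = F 0"
      using nz by (subst circle_mean_value) (auto intro!: continuous_intros holomorphic_intros F)
    finally show ?thesis .
  qed
  have "(\<integral>\<zeta>. complex_of_real (Re (F \<zeta>)) * ((\<zeta> + z) / (\<zeta> - z)) \<partial>circle_measure)
      = (\<integral>\<zeta>. (F \<zeta> * ((\<zeta> + z) / (\<zeta> - z)) + cnj (F \<zeta>) * ((\<zeta> + z) / (\<zeta> - z))) / 2 \<partial>circle_measure)"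
    by (intro Bochner_Integration.integral_cong refl) 
       (simp add: complex_add_cnj ring_distribs[symmetric] del: times_divide_eq_right)
  also have "\<dots> = (2 * F z - F 0 + cnj (F 0)) / 2"
    unfolding integral_divide_zero
    by (subst Bochner_Integration.integral_add)
       (auto intro!: integrable_circle_continuous continuous_intros Fs K
         simp: A B simp del: times_divide_eq_right dest: ne)
  also have "\<dots> = F z - \<i> * Im (F 0)"
    using complex_diff_cnj[of "F 0"] by (simp add: field_simps)
  finally show ?thesis .
qed

section \<open>A maximum principle\<close>

text \<open>Real trigonometric polynomials, extended harmonically to the plane. The real part
  absorbs negative frequencies, so natural exponents suffice and each member is the real part of a
  polynomial. Products stay in the class only after restriction to the circle.\<close>

inductive circle_trig :: "(complex \<Rightarrow> real) \<Rightarrow> bool" where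
  monom: "circle_trig (\<lambda>\<zeta>. Re (c * \<zeta> ^ n))"
| add: "circle_trig p \<Longrightarrow> circle_trig q \<Longrightarrow> circle_trig (\<lambda>\<zeta>. p \<zeta> + q \<zeta>)"

lemma circle_trig_Re_holomorphic:
  "circle_trig q \<Longrightarrow> \<exists>p. p holomorphic_on UNIV \<and> (\<forall>\<zeta>. q \<zeta> = Re (p \<zeta>))"
proof (induction rule: circle_trig.induct)
  case (monom c n)
  show ?case
    by (rule exI[of _ "\<lambda>\<zeta>. c * \<zeta> ^ n"]) (auto intro!: holomorphic_intros)
next
  case (add q1 q2)
  then obtain p1 p2 where "p1 holomorphic_on UNIV" "p2 holomorphic_on UNIV"
    "\<forall>\<zeta>. q1 \<zeta> = Re (p1 \<zeta>)" "\<forall>\<zeta>. q2 \<zeta> = Re (p2 \<zeta>)" by blast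
  then show ?case
    by (intro exI[of _ "\<lambda>\<zeta>. p1 \<zeta> + p2 \<zeta>"]) (auto intro!: holomorphic_intros)
qed

lemma Re_times_Re: "Re a * Re b = Re (a * b / 2) + Re (a * cnj b / 2)"
  by (simp add: field_simps)

lemma power_mult_cnj_power:
  assumes "norm \<zeta> = 1" "m \<le> n"
  shows "\<zeta> ^ n * cnj \<zeta> ^ m = \<zeta> ^ (n - m)"
proof -
  have "\<zeta> * cnj \<zeta> = 1" using assms(1) complex_norm_square[of \<zeta>] by simp
  have "\<zeta> ^ n = \<zeta> ^ (n - m) * \<zeta> ^ m" using assms(2) by (simp flip: power_add)
  then have "\<zeta> ^ n * cnj \<zeta> ^ m = \<zeta> ^ (n - m) * (\<zeta> * cnj \<zeta>) ^ m"
    by (simp add: power_mult_distrib)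
  then show ?thesis using \<open>\<zeta> * cnj \<zeta> = 1\<close> by simp
qed

text \<open>The product-to-sum formula:
  \<open>2 * Re a * Re b = Re (a * b) + Re (a * cnj b)\<close>, and on the circle conjugation
  inverts powers of \<zeta>. Which factor gets conjugated depends on the larger exponent, so that
  the difference of exponents stays a natural number.\<close>

lemma circle_trig_mult_monom:
  "\<exists>r. circle_trig r \<and> (\<forall>\<zeta>\<in>sphere 0 1. Re (c * \<zeta> ^ n) * Re (d * \<zeta> ^ m) = r \<zeta>)"
proof (cases "m \<le> n")
  case True
  show ?thesis
  proof (intro exI conjI ballI)
    show "circle_trig (\<lambda>\<zeta>. Re (c * d / 2 * \<zeta> ^ (n + m)) + Re (c * cnj d / 2 * \<zeta> ^ (n - m)))"
      by (intro circle_trig.intros)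
    fix \<zeta> :: complex assume "\<zeta> \<in> sphere 0 1"
    then have "c * cnj d / 2 * \<zeta> ^ (n - m) = (c * \<zeta> ^ n) * cnj (d * \<zeta> ^ m) / 2"
      using power_mult_cnj_power[OF _ True, of \<zeta>] by simp
    moreover have "c * d / 2 * \<zeta> ^ (n + m) = (c * \<zeta> ^ n) * (d * \<zeta> ^ m) / 2"
      by (simp add: power_add)
    ultimately show "Re (c * \<zeta> ^ n) * Re (d * \<zeta> ^ m)
        = Re (c * d / 2 * \<zeta> ^ (n + m)) + Re (c * cnj d / 2 * \<zeta> ^ (n - m))"
      unfolding Re_times_Re[of "c * \<zeta> ^ n"] by (simp only:)
  qed
next
  case False
  then have nm: "n \<le> m" by simp
  show ?thesis
  proof (intro exI conjI ballI)
    show "circle_trig (\<lambda>\<zeta>. Re (d * c / 2 * \<zeta> ^ (m + n)) + Re (d * cnj c / 2 * \<zeta> ^ (m - n)))"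
      by (intro circle_trig.intros)
    fix \<zeta> :: complex assume "\<zeta> \<in> sphere 0 1"
    then have "d * cnj c / 2 * \<zeta> ^ (m - n) = (d * \<zeta> ^ m) * cnj (c * \<zeta> ^ n) / 2"
      using power_mult_cnj_power[OF _ nm, of \<zeta>] by simp
    moreover have "d * c / 2 * \<zeta> ^ (m + n) = (d * \<zeta> ^ m) * (c * \<zeta> ^ n) / 2"
      by (simp add: power_add)
    ultimately show "Re (c * \<zeta> ^ n) * Re (d * \<zeta> ^ m)
        = Re (d * c / 2 * \<zeta> ^ (m + n)) + Re (d * cnj c / 2 * \<zeta> ^ (m - n))"
      unfolding mult.commute[of "Re (c * \<zeta> ^ n)"] Re_times_Re[of "d * \<zeta> ^ m"] by (simp only:)
  qed
qed

lemma circle_trig_mult: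
  assumes "circle_trig p" "circle_trig q"
  shows "\<exists>r. circle_trig r \<and> (\<forall>\<zeta>\<in>sphere 0 1. p \<zeta> * q \<zeta> = r \<zeta>)"
  using assms(1)
proof (induction rule: circle_trig.induct)
  case (monom c n)
  show ?case using assms(2)
  proof (induction rule: circle_trig.induct)
    case (monom d m)
    show ?case by (rule circle_trig_mult_monom)
  next
    case (add q1 q2)
    then obtain r1 r2 where "circle_trig r1" "circle_trig r2"
      "\<forall>\<zeta>\<in>sphere 0 1. Re (c * \<zeta> ^ n) * q1 \<zeta> = r1 \<zeta>" "\<forall>\<zeta>\<in>sphere 0 1. Re (c * \<zeta> ^ n) * q2 \<zeta> = r2 \<zeta>"
      by blast
    then show ?case
      by (intro exI[of _ "\<lambda>\<zeta>. r1 \<zeta> + r2 \<zeta>"]) (simp add: circle_trig.add distrib_left)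
  qed
next
  case (add p1 p2)
  then obtain r1 r2 where "circle_trig r1" "circle_trig r2"
    "\<forall>\<zeta>\<in>sphere 0 1. p1 \<zeta> * q \<zeta> = r1 \<zeta>" "\<forall>\<zeta>\<in>sphere 0 1. p2 \<zeta> * q \<zeta> = r2 \<zeta>"
    by blast
  then show ?case
    by (intro exI[of _ "\<lambda>\<zeta>. r1 \<zeta> + r2 \<zeta>"]) (simp add: circle_trig.add distrib_right)
qed

lemma real_polynomial_function_circle_trig:
  fixes q :: "complex \<Rightarrow> real"
  assumes "real_polynomial_function q"
  shows "\<exists>r. circle_trig r \<and> (\<forall>\<zeta>\<in>sphere 0 1. q \<zeta> = r \<zeta>)"
  using assms
proof (induction rule: real_polynomial_function.induct)
  case (linear f)
  interpret bounded_linear f by fact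
  \<comment> \<open>A real-linear functional on the plane is \<open>x * f 1 + y * f \<i>\<close>,
    and this is the real part of \<open>(f 1 - \<i> * f \<i>) * (x + \<i> * y)\<close>.\<close>
  have "f \<zeta> = Re (Complex (f 1) (- f \<i>) * \<zeta> ^ 1)" for \<zeta>
  proof -
    have "f \<zeta> = f (Re \<zeta> *\<^sub>R 1 + Im \<zeta> *\<^sub>R \<i>)"
      by (rule arg_cong[of _ _ f]) (simp add: complex_eq_iff)
    then show ?thesis by (simp only: add scaleR) (simp add: mult.commute)
  qed
  then show ?case using circle_trig.monom[of "Complex (f 1) (- f \<i>)" 1] by blast
next
  case (const c)
  then show ?case
    using circle_trig.monom[of "of_real c" 0] by auto
next
  case (add f g)
  then obtain r1 r2 where "circle_trig r1" "circle_trig r2"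
    "\<forall>\<zeta>\<in>sphere 0 1. f \<zeta> = r1 \<zeta>" "\<forall>\<zeta>\<in>sphere 0 1. g \<zeta> = r2 \<zeta>"
    by blast
  then show ?case
    by (intro exI[of _ "\<lambda>\<zeta>. r1 \<zeta> + r2 \<zeta>"]) (simp add: circle_trig.add)
next
  case (mult f g)
  then obtain r1 r2 where r: "circle_trig r1" "circle_trig r2"
    "\<forall>\<zeta>\<in>sphere 0 1. f \<zeta> = r1 \<zeta>" "\<forall>\<zeta>\<in>sphere 0 1. g \<zeta> = r2 \<zeta>"
    by blast
  then show ?case
    using circle_trig_mult[OF r(1,2)] by auto
qed

text \<open>Takes the place of solving the Dirichlet problem: Stone-Weierstrass gives a polynomial
  in the real coordinates, which agrees on the circle with a trigonometric polynomial and hence with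
  the real part of an entire function.\<close>

lemma circle_approx_Re_entire:
  fixes F :: "complex \<Rightarrow> real"
  assumes "continuous_on (sphere 0 1) F" "0 < e"
  obtains p where "p holomorphic_on UNIV" "\<And>\<zeta>. norm \<zeta> = 1 \<Longrightarrow> \<bar>F \<zeta> - Re (p \<zeta>)\<bar> < e"
proof -
  obtain q where q: "real_polynomial_function q" "\<And>x. x \<in> sphere 0 1 \<Longrightarrow> \<bar>F x - q x\<bar> < e"
    using Stone_Weierstrass_real_polynomial_function[OF compact_sphere assms] by blast
  obtain r where r: "circle_trig r" "\<forall>\<zeta>\<in>sphere 0 1. q \<zeta> = r \<zeta>"
    using real_polynomial_function_circle_trig[OF q(1)] by blast
  obtain p where "p holomorphic_on UNIV" "\<forall>\<zeta>. r \<zeta> = Re (p \<zeta>)"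
    using circle_trig_Re_holomorphic[OF r(1)] by blast
  with q(2) r(2) show ?thesis
    by (intro that[of p]) auto
qed

text \<open>The substitute for subharmonicity: every value of \<open>F\<close> is attained by the real part of a
  local holomorphic minorant.\<close>

definition locally_touched_below :: "complex set \<Rightarrow> (complex \<Rightarrow> real) \<Rightarrow> bool" where
  "locally_touched_below S F \<longleftrightarrow> (\<forall>z\<in>S. \<exists>h e. 0 < e \<and> h holomorphic_on ball z e \<and>
     Re (h z) = F z \<and> (\<forall>w\<in>ball z e. Re (h w) \<le> F w))"

text \<open>Among the maximum points of \<open>F - Re p\<close> on the closed disc, one of largest
  modulus is chosen. In the interior it would have a whole neighbourhood of maximum points, some of
  them farther out; so it lies on the circle, where the difference is at most 0.\<close>

lemma locally_touched_below_maximum_principle: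
  assumes contF: "continuous_on (cball 0 1) F"
    and touch: "locally_touched_below (ball 0 1) F"
    and p: "p holomorphic_on UNIV"
    and bdry: "\<And>\<zeta>. norm \<zeta> = 1 \<Longrightarrow> F \<zeta> \<le> Re (p \<zeta>)"
    and z: "norm z \<le> 1"
  shows "F z \<le> Re (p z)"
proof -
  define G where "G z = F z - Re (p z)" for z
  have contG: "continuous_on (cball 0 1) G"
    unfolding G_def by (intro continuous_intros contF holomorphic_on_imp_continuous_on
        holomorphic_on_subset[OF p]) auto
  obtain x where x: "x \<in> cball 0 1" "\<And>y. y \<in> cball 0 1 \<Longrightarrow> G y \<le> G x"
    using continuous_attains_sup[OF compact_cball _ contG] by auto
  define K where "K = {y \<in> cball 0 1. G y = G x}"
  have "compact K"
    unfolding K_def using continuous_closed_preimage_constant[OF contG, of "G x"]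
    by (auto simp: compact_eq_bounded_closed intro: bounded_subset[OF bounded_cball[of 0 1]])
  then obtain z0 where z0: "z0 \<in> K" "\<And>y. y \<in> K \<Longrightarrow> norm y \<le> norm z0"
    using continuous_attains_sup[of K norm] x by (auto simp: K_def intro: continuous_intros)
  have "norm z0 = 1"
  proof (rule ccontr)
    assume "norm z0 \<noteq> 1"
    then have z0b: "z0 \<in> ball 0 1" using z0(1) by (auto simp: K_def)
    then obtain h e where e: "0 < e" "h holomorphic_on ball z0 e" "Re (h z0) = F z0"
      "\<And>w. w \<in> ball z0 e \<Longrightarrow> Re (h w) \<le> F w"
      using touch unfolding locally_touched_below_def by blast
    define d where "d = min e (1 - norm z0)"
    have d: "0 < d" "d \<le> e" using e(1) z0b by (auto simp: d_def)
    have sub: "w \<in> cball 0 1" if "w \<in> ball z0 d" for w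
      using that norm_triangle_ineq2[of w z0] by (auto simp: d_def dist_norm norm_minus_commute)
    \<comment> \<open>Its modulus is \<open>exp (Re (h w) - Re (p w))\<close>, at most
      \<open>exp (G w)\<close> with equality at \<open>z0\<close>. So a maximum of \<open>G\<close>
      at \<open>z0\<close> is a local maximum of the modulus of a holomorphic function.\<close>
    let ?k = "\<lambda>w. exp (h w - p w)"
    have "?k constant_on ball z0 d"
    proof (rule maximum_modulus_principle)
      show "?k holomorphic_on ball z0 d"
        using d by (intro holomorphic_intros holomorphic_on_subset[OF e(2)] holomorphic_on_subset[OF p]) auto
      show "cmod (?k w) \<le> cmod (?k z0)" if "w \<in> ball z0 d" for w
        using x(2)[OF sub[OF that]] e(4)[of w] e(3) that d z0(1) by (auto simp: K_def G_def)
    qed (use d in auto)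
    then obtain c where "\<And>w. w \<in> ball z0 d \<Longrightarrow> ?k w = c"
      unfolding constant_on_def by blast
    then have const: "?k w = ?k z0" if "w \<in> ball z0 d" for w
      using that d by simp
    have inK: "w \<in> K" if w: "w \<in> ball z0 d" for w
    proof -
      have "cmod (?k w) = cmod (?k z0)" using const[OF w] by simp
      then have "Re (h w) - Re (p w) = G x"
        using e(3) z0(1) by (simp add: K_def G_def)
      then have "G x \<le> G w" using e(4)[of w] w d by (auto simp: G_def)
      then show ?thesis using x(2)[OF sub[OF w]] sub[OF w] by (auto simp: K_def)
    qed
    \<comment> \<open>The outward radial direction at \<open>z0\<close>; at the origin any unit
      direction leads outward.\<close>
    define u where "u = (if z0 = 0 then 1 else sgn z0)"
    define w where "w = z0 + of_real (d/2) * u"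
    have u: "norm u = 1" by (simp add: u_def norm_sgn)
    have "w \<in> ball z0 d" using d u by (simp add: w_def dist_norm norm_mult)
    moreover have "norm w = norm z0 + d/2"
    proof -
      have "w = of_real (norm z0 + d/2) * u"
        by (auto simp: w_def u_def sgn_eq field_simps)
      then show ?thesis using d u by (simp only: norm_mult norm_of_real)
        (simp add: u)
    qed
    ultimately show False using z0(2)[OF inK[of w]] d by linarith
  qed
  then have "G x \<le> 0" using bdry[of z0] z0(1) by (simp add: K_def G_def)
  then show ?thesis using x(2)[of z] z by (simp add: G_def)
qed

text \<open>An entire \<open>p\<close> whose real part lies slightly above \<open>F\<close> on the
  unit circle dominates \<open>F\<close> inside by the maximum principle, and the mean of
  \<open>Re p\<close> is \<open>Re (p 0)\<close> on every circle about the origin.\<close>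

lemma locally_touched_below_circle_mean_mono:
  assumes contF: "continuous_on (cball 0 1) F"
    and touch: "locally_touched_below (ball 0 1) F"
    and r: "0 \<le> r" "r \<le> 1"
  shows "(\<integral>\<zeta>. F (of_real r * \<zeta>) \<partial>circle_measure) \<le> (\<integral>\<zeta>. F \<zeta> \<partial>circle_measure)"
proof (rule field_le_epsilon)
  fix e :: real assume e: "0 < e"
  have Fs: "continuous_on (sphere 0 1) F"
    by (rule continuous_on_subset[OF contF]) auto
  have Fr: "continuous_on (sphere 0 1) (\<lambda>\<zeta>. F (of_real r * \<zeta>))"
    using r by (intro continuous_on_compose2[OF contF] continuous_intros) (auto simp: norm_mult)
  \<comment> \<open>Approximating \<open>F + e/2\<close> to within \<open>e/2\<close> places
    \<open>Re p\<close> between \<open>F\<close> and \<open>F + e\<close> on the circle.\<close>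
  obtain p where p: "p holomorphic_on UNIV" "\<And>\<zeta>. norm \<zeta> = 1 \<Longrightarrow> \<bar>(F \<zeta> + e/2) - Re (p \<zeta>)\<bar> < e/2"
  proof (rule circle_approx_Re_entire)
    show "continuous_on (sphere 0 1) (\<lambda>\<zeta>. F \<zeta> + e/2)" by (intro continuous_intros Fs)
    show "0 < e/2" using e by simp
  qed (rule that)
  have pc: "continuous_on S p" for S
    using holomorphic_on_imp_continuous_on[OF p(1)] continuous_on_subset by blast
  have prh: "(\<lambda>\<zeta>. p (of_real r * \<zeta>)) holomorphic_on S" for S
    by (intro holomorphic_on_compose_gen[OF _ p(1), unfolded o_def] holomorphic_intros) auto
  have prc: "continuous_on S (\<lambda>\<zeta>. p (of_real r * \<zeta>))" for S
    by (intro holomorphic_on_imp_continuous_on prh)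
  have le: "F z \<le> Re (p z)" if "norm z \<le> 1" for z
  proof (rule locally_touched_below_maximum_principle[OF contF touch p(1) _ that])
    show "F \<zeta> \<le> Re (p \<zeta>)" if "norm \<zeta> = 1" for \<zeta> using p(2)[OF that] by linarith
  qed
  have "(\<integral>\<zeta>. F (of_real r * \<zeta>) \<partial>circle_measure) \<le> (\<integral>\<zeta>. Re (p (of_real r * \<zeta>)) \<partial>circle_measure)"
    using r by (intro integral_mono integrable_circle_continuous Fr le continuous_intros prc)
      (auto simp: norm_mult)
  also have "\<dots> = Re (\<integral>\<zeta>. p (of_real r * \<zeta>) \<partial>circle_measure)"
    by (intro integral_Re integrable_circle_continuous prc)
  also have "\<dots> = Re (\<integral>\<zeta>. p \<zeta> \<partial>circle_measure)"
    by (subst (1 2) circle_mean_value) (auto intro: prc prh pc holomorphic_on_subset[OF p(1)])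
  also have "\<dots> = (\<integral>\<zeta>. Re (p \<zeta>) \<partial>circle_measure)"
    by (intro integral_Re[symmetric] integrable_circle_continuous pc)
  also have "\<dots> \<le> (\<integral>\<zeta>. F \<zeta> + e \<partial>circle_measure)"
  proof (intro integral_mono integrable_circle_continuous continuous_intros Fs pc)
    fix \<zeta> assume "\<zeta> \<in> space circle_measure"
    then have "\<bar>(F \<zeta> + e/2) - Re (p \<zeta>)\<bar> < e/2" by (intro p(2)) simp
    then show "Re (p \<zeta>) \<le> F \<zeta> + e" by linarith
  qed
  also have "\<dots> = (\<integral>\<zeta>. F \<zeta> \<partial>circle_measure) + e"
    by (subst Bochner_Integration.integral_add) (auto intro!: integrable_circle_continuous Fs)
  finally show "(\<integral>\<zeta>. F (of_real r * \<zeta>) \<partial>circle_measure) \<le> (\<integral>\<zeta>. F \<zeta> \<partial>circle_measure) + e" .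
qed

section \<open>The truncation of the absolute real part\<close>

text \<open>This is \<open>\<Phi>\<^sub>R\<close>: for \<open>norm w \<ge> R\<close> the first
  summand is the absolute value of \<open>Re (R\<^sup>2 / w)\<close>. Writing
  \<open>max R (norm w)\<close> merges the two branches into one formula that is visibly
  continuous.\<close>

definition truncated_abs_Re :: "real \<Rightarrow> complex \<Rightarrow> real" where
  "truncated_abs_Re R w = \<bar>Re w\<bar> * (R / max R (norm w))\<^sup>2 + 3 * R * ln (max R (norm w) / R)"

lemma truncated_abs_Re_inside:
  "0 < R \<Longrightarrow> norm w \<le> R \<Longrightarrow> truncated_abs_Re R w = \<bar>Re w\<bar>"
  by (simp add: truncated_abs_Re_def)

lemma truncated_abs_Re_le:
  assumes "0 < R"
  shows "truncated_abs_Re R w \<le> \<bar>Re w\<bar> + 3 * R * ln (max R (norm w) / R)"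
proof -
  have "(R / max R (norm w))\<^sup>2 \<le> 1"
    using assms by (intro power_le_one) auto
  then have "\<bar>Re w\<bar> * (R / max R (norm w))\<^sup>2 \<le> \<bar>Re w\<bar> * 1"
    by (rule mult_left_mono) simp
  then show ?thesis by (simp add: truncated_abs_Re_def)
qed

lemma truncated_abs_Re_nonneg: "0 < R \<Longrightarrow> 0 \<le> truncated_abs_Re R w"
  by (simp add: truncated_abs_Re_def)

text \<open>With \<open>m = max R (norm w)\<close> the first summand is at most
  \<open>R\<^sup>2 / m\<close>, hence at most \<open>R\<close>, and \<open>R \<ge> 1\<close> gives
  \<open>m / R \<le> max 1 (norm w)\<close>. This bound makes the function in the application of
  Fatou's lemma nonnegative.\<close>

lemma truncated_abs_Re_le_log_growth:
  assumes "1 \<le> R"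
  shows "truncated_abs_Re R w \<le> R + 3 * R * ln (max 1 (norm w))"
proof -
  define m where "m = max R (norm w)"
  have m: "0 < m" "norm w \<le> m" "R \<le> m" using assms by (auto simp: m_def)
  have "\<bar>Re w\<bar> * (R / m)\<^sup>2 \<le> m * (R / m)\<^sup>2"
    using abs_Re_le_cmod[of w] m by (intro mult_right_mono) auto
  also have "\<dots> = R * (R / m)" using m by (simp add: power2_eq_square)
  also have "\<dots> \<le> R * 1" using m assms by (intro mult_left_mono) auto
  finally have 1: "\<bar>Re w\<bar> * (R / m)\<^sup>2 \<le> R" by simp
  have "m / R \<le> max 1 (norm w)"
  proof (cases "norm w \<le> R")
    case True
    then have "m = R" by (simp add: m_def)
    then show ?thesis using assms by simp
  next
    case False
    then have "m / R \<le> norm w / 1" unfolding m_def using assms by (intro divide_mono) auto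
    then show ?thesis by simp
  qed
  then have "ln (m / R) \<le> ln (max 1 (norm w))"
    using m assms by (subst ln_le_cancel_iff) auto
  then have "3 * R * ln (m / R) \<le> 3 * R * ln (max 1 (norm w))"
    using assms by (intro mult_left_mono) auto
  with 1 show ?thesis by (simp add: truncated_abs_Re_def m_def)
qed

text \<open>The constant 3 enters here: \<open>q - 1/q \<le> 3 ln q\<close> for \<open>1 \<le> q \<le> 2\<close>.\<close>

lemma truncated_abs_Re_ge:
  assumes R: "0 < R" and w: "norm w \<le> 2 * R"
  shows "\<bar>Re w\<bar> \<le> truncated_abs_Re R w"
proof (cases "norm w \<le> R")
  case True
  then show ?thesis using truncated_abs_Re_inside[OF R] by simp
next
  case False
  define q where "q = norm w / R"
  have q: "1 < q" "q \<le> 2" "norm w = q * R" using False R w by (auto simp: q_def field_simps)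
  have "\<bar>Re w\<bar> * (1 - 1 / q\<^sup>2) \<le> (q * R) * (1 - 1 / q\<^sup>2)"
    using abs_Re_le_cmod[of w] q by (intro mult_right_mono) (auto simp: field_simps)
  also have "\<dots> = R * ((q + 1) * (1 - 1 / q))"
    using q by (simp add: field_simps power2_eq_square)
  also have "\<dots> \<le> R * (3 * ln q)"
  proof (intro mult_left_mono mult_mono)
    have "ln (1 / q) \<le> 1 / q - 1" using q by (intro ln_le_minus_one) auto
    then show "1 - 1 / q \<le> ln q" using q by (simp add: ln_div)
  qed (use q R in auto)
  finally have "\<bar>Re w\<bar> \<le> \<bar>Re w\<bar> * (1 / q)\<^sup>2 + 3 * R * ln q"
    by (simp add: algebra_simps power_divide)
  moreover have "truncated_abs_Re R w = \<bar>Re w\<bar> * (1 / q)\<^sup>2 + 3 * R * ln q"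
    using q R False by (simp add: truncated_abs_Re_def max_def)
  ultimately show ?thesis by simp
qed

lemma continuous_on_truncated_abs_Re: "0 < R \<Longrightarrow> continuous_on S (truncated_abs_Re R)"
  unfolding truncated_abs_Re_def by (intro continuous_intros) auto

lemma ex_sign_Re: obtains \<sigma> :: real where "\<sigma> * x = \<bar>x\<bar>" "\<And>y. \<sigma> * y \<le> \<bar>y\<bar>"
  by (rule that[of "if 0 \<le> x then 1 else -1"]) auto

text \<open>With the sign \<sigma> of \<open>Re (f z)\<close> frozen, both branches become real
  parts of holomorphic functions: \<open>\<sigma> * f\<close> in the inner region, and
  \<open>\<sigma> * R\<^sup>2 / f\<close> plus \<open>3 * R\<close> times a logarithm of
  \<open>f / R\<close> in the outer one. Freezing the sign can only decrease an absolute value, and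
  changes nothing at \<open>z\<close>.\<close>

lemma locally_touched_below_truncated_abs_Re:
  assumes f: "f holomorphic_on S" and S: "open S" and R: "0 < R"
  shows "locally_touched_below S (\<lambda>z. truncated_abs_Re R (f z))"
  unfolding locally_touched_below_def
proof
  fix z assume z: "z \<in> S"
  have contf: "continuous_on S f" by (rule holomorphic_on_imp_continuous_on[OF f])
  have near: "\<exists>e>0. ball z e \<subseteq> S \<and> (\<forall>w\<in>ball z e. P (f w))" if "open {v. P v}" "P (f z)" for P
  proof -
    have "open (S \<inter> f -` {v. P v})"
      using contf S that(1) by (rule continuous_open_preimage)
    moreover have "z \<in> S \<inter> f -` {v. P v}" using z that by simp
    ultimately obtain e where "0 < e" "ball z e \<subseteq> S \<inter> f -` {v. P v}"
      unfolding open_contains_ball by blast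
    then show ?thesis by (intro exI[of _ e]) auto
  qed
  obtain \<sigma> where \<sigma>: "\<sigma> * Re (f z) = \<bar>Re (f z)\<bar>" "\<And>y. \<sigma> * y \<le> \<bar>y\<bar>"
    using ex_sign_Re by blast
  show "\<exists>h e. 0 < e \<and> h holomorphic_on ball z e \<and> Re (h z) = truncated_abs_Re R (f z) \<and>
     (\<forall>w\<in>ball z e. Re (h w) \<le> truncated_abs_Re R (f w))"
  proof (cases "norm (f z) \<le> R")
    case True
    \<comment> \<open>If \<open>norm (f z) = R\<close>, nearby values may leave the inner region;
      below modulus \<open>2 * R\<close> the inner branch is still a minorant by
      \<open>truncated_abs_Re_ge\<close>.\<close>
    have "\<exists>e>0. ball z e \<subseteq> S \<and> (\<forall>w\<in>ball z e. norm (f w) < 2 * R)"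
      using True R by (intro near open_Collect_less continuous_intros) auto
    then obtain e where e: "0 < e" "ball z e \<subseteq> S" "\<And>w. w \<in> ball z e \<Longrightarrow> norm (f w) < 2 * R"
      by blast
    show ?thesis
    proof (intro exI[of _ "\<lambda>w. of_real \<sigma> * f w"] exI[of _ e] conjI ballI)
      show "(\<lambda>w. of_real \<sigma> * f w) holomorphic_on ball z e"
        by (intro holomorphic_intros holomorphic_on_subset[OF f] e)
      show "Re (of_real \<sigma> * f z) = truncated_abs_Re R (f z)"
        using \<sigma>(1) truncated_abs_Re_inside[OF R True] by simp
      fix w assume "w \<in> ball z e"
      then have "\<bar>Re (f w)\<bar> \<le> truncated_abs_Re R (f w)"
        using e(3) R by (intro truncated_abs_Re_ge) (auto intro: less_imp_le)
      then show "Re (of_real \<sigma> * f w) \<le> truncated_abs_Re R (f w)"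
        using \<sigma>(2)[of "Re (f w)"] by simp
    qed (rule e)
  next
    case False
    define a where "a = f z"
    have a: "a \<noteq> 0" "R < norm a" using False R by (auto simp: a_def)
    have "\<exists>e>0. ball z e \<subseteq> S \<and> (\<forall>w\<in>ball z e. R < norm (f w))"
      using False by (intro near open_Collect_less continuous_intros) auto
    then obtain e1 where e1: "0 < e1" "ball z e1 \<subseteq> S" "\<And>w. w \<in> ball z e1 \<Longrightarrow> R < norm (f w)"
      by blast
    \<comment> \<open>Dividing by \<open>a = f z\<close> keeps the quotient in the disc of radius 1
      about 1, off the branch cut of \<open>Ln\<close>. The definition of \<open>h\<close> restores
      the lost modulus by adding \<open>ln (norm a / R)\<close>.\<close>
    have "\<exists>e>0. ball z e \<subseteq> S \<and> (\<forall>w\<in>ball z e. norm (f w / a - 1) < 1)"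
      using a by (intro near[of "\<lambda>v. norm (v / a - 1) < 1"] open_Collect_less continuous_intros) (auto simp: a_def)
    then obtain e2 where e2: "0 < e2" "\<And>w. w \<in> ball z e2 \<Longrightarrow> norm (f w / a - 1) < 1"
      by blast
    define e where "e = min e1 e2"
    have ne: "f w \<noteq> 0" if "w \<in> ball z e" for w
      using e1(3)[of w] that R by (auto simp: e_def)
    have nonpos: "f w / a \<notin> \<real>\<^sub>\<le>\<^sub>0" if "w \<in> ball z e" for w
    proof
      assume "f w / a \<in> \<real>\<^sub>\<le>\<^sub>0"
      then have "Re (f w / a) \<le> 0" by (auto simp: nonpos_Reals_def)
      moreover have "\<bar>Re (f w / a - 1)\<bar> < 1"
        using e2(2)[of w] that abs_Re_le_cmod[of "f w / a - 1"] by (auto simp: e_def)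
      ultimately show False by simp
    qed
    define h where "h w = of_real (\<sigma> * R\<^sup>2) / f w + of_real (3 * R) * (Ln (f w / a) + of_real (ln (norm a / R)))" for w
    have Reh: "Re (h w) = \<sigma> * Re (f w) * (R / norm (f w))\<^sup>2 + 3 * R * ln (norm (f w) / R)"
      if "w \<in> ball z e" for w
    proof -
      have "Re (Ln (f w / a)) + ln (norm a / R) = ln (norm (f w) / R)"
        using ne[OF that] a R by (simp add: ln_div norm_divide)
      moreover have "Re (of_real (\<sigma> * R\<^sup>2) / f w) = \<sigma> * Re (f w) * (R / norm (f w))\<^sup>2"
        by (simp add: Re_divide cmod_power2 power_divide del: of_real_mult of_real_power) 
      ultimately show ?thesis unfolding h_def
        by (simp del: of_real_mult of_real_power)
    qed
    have tr: "truncated_abs_Re R (f w) = \<bar>Re (f w)\<bar> * (R / norm (f w))\<^sup>2 + 3 * R * ln (norm (f w) / R)"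
      if "w \<in> ball z e" for w
      using e1(3)[of w] that by (simp add: truncated_abs_Re_def max_def e_def)
    have zb: "z \<in> ball z e" using e1 e2 by (simp add: e_def)
    show ?thesis
    proof (intro exI[of _ h] exI[of _ e] conjI ballI)
      show "0 < e" using zb by simp
      have "f holomorphic_on ball z e" using e1 by (intro holomorphic_on_subset[OF f]) (auto simp: e_def)
      then show "h holomorphic_on ball z e"
        unfolding h_def using ne nonpos a
        by (intro holomorphic_intros) auto
      show "Re (h z) = truncated_abs_Re R (f z)"
        using Reh[OF zb] tr[OF zb] \<sigma>(1) by simp
      fix w assume w: "w \<in> ball z e"
      show "Re (h w) \<le> truncated_abs_Re R (f w)"
        unfolding Reh[OF w] tr[OF w] using \<sigma>(2)[of "Re (f w)"] by (intro add_right_mono mult_right_mono) auto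
    qed
  qed
qed

section \<open>Passage to the boundary\<close>

lemma nn_integral_inverse_Icc:
  assumes "0 < R"
  shows "(\<integral>\<^sup>+t. ennreal (1 / t) * indicator {R..x} t \<partial>lborel) = ennreal (ln (max R x / R))"
proof (cases "R \<le> x")
  case True
  have "(\<integral>\<^sup>+t. ennreal (1 / t) * indicator {R..x} t \<partial>lborel) = ennreal (ln x - ln R)"
    using assms True by (intro nn_integral_FTC_Icc) (auto intro!: derivative_eq_intros)
  also have "ln x - ln R = ln (max R x / R)"
    using assms True by (simp add: ln_div max_def)
  finally show ?thesis .
qed (use assms in auto)

lemma measurable_circle_ident [measurable]: "(\<lambda>\<zeta>. \<zeta>) \<in> borel_measurable circle_measure"
  by (rule borel_measurable_circle_continuous) (rule continuous_on_id)

text \<open>A layer-cake formula: Tonelli for \<open>1 / t\<close> on the set of pairs with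
  \<open>R \<le> t \<le> norm (g \<zeta>)\<close>. Integrating first over \<zeta> produces the
  distribution function, integrating first over \<open>t\<close> the logarithm.\<close>

lemma tail_integral_eq_log_integral:
  assumes g [measurable]: "g \<in> borel_measurable circle_measure" and R: "0 < R"
  shows "(\<integral>\<^sup>+ t\<in>{R..}. ennreal (distrib_fun g t / t) \<partial>lborel)
    = (\<integral>\<^sup>+\<zeta>. ennreal (ln (max R (norm (g \<zeta>)) / R)) \<partial>circle_measure)"
proof -
  interpret pair_sigma_finite lborel circle_measure ..
  have inner: "ennreal (distrib_fun g t / t) * indicator {R..} t
      = (\<integral>\<^sup>+\<zeta>. ennreal (1 / t) * indicator {R..norm (g \<zeta>)} t \<partial>circle_measure)" for t
  proof (cases "R \<le> t")
    case True
    have "(\<integral>\<^sup>+\<zeta>. ennreal (1 / t) * indicator {R..norm (g \<zeta>)} t \<partial>circle_measure)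
      = (\<integral>\<^sup>+\<zeta>. ennreal (1 / t) * indicator {\<zeta>\<in>space circle_measure. norm (g \<zeta>) \<ge> t} \<zeta> \<partial>circle_measure)"
      using True by (intro nn_integral_cong) (auto split: split_indicator)
    also have "\<dots> = ennreal (1 / t) * emeasure circle_measure {\<zeta>\<in>space circle_measure. norm (g \<zeta>) \<ge> t}"
      by (intro nn_integral_cmult_indicator) measurable
    also have "\<dots> = ennreal (distrib_fun g t / t)"
      using True R by (simp add: circle.emeasure_eq_measure distrib_fun_def flip: ennreal_mult)
    finally show ?thesis using True by simp
  qed (auto split: split_indicator)
  have "(\<integral>\<^sup>+ t\<in>{R..}. ennreal (distrib_fun g t / t) \<partial>lborel)
      = (\<integral>\<^sup>+t. (\<integral>\<^sup>+\<zeta>. ennreal (1 / t) * indicator {R..norm (g \<zeta>)} t \<partial>circle_measure) \<partial>lborel)"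
    by (simp only: inner)
  also have "\<dots> = (\<integral>\<^sup>+\<zeta>. (\<integral>\<^sup>+t. ennreal (1 / t) * indicator {R..norm (g \<zeta>)} t \<partial>lborel) \<partial>circle_measure)"
  proof (rule Fubini'[symmetric])
    have "(\<lambda>p. ennreal (1 / fst p) * indicator {p. R \<le> fst p \<and> fst p \<le> norm (g (snd p))} p)
        \<in> borel_measurable (lborel \<Otimes>\<^sub>M circle_measure)"
      by measurable
    also have "(\<lambda>p. ennreal (1 / fst p) * indicator {p. R \<le> fst p \<and> fst p \<le> norm (g (snd p))} p)
       = (\<lambda>(t, \<zeta>). ennreal (1 / t) * indicator {R..norm (g \<zeta>)} t)"
      by (auto split: split_indicator)
    finally show "(\<lambda>(t, \<zeta>). ennreal (1 / t) * indicator {R..norm (g \<zeta>)} t)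
        \<in> borel_measurable (lborel \<Otimes>\<^sub>M circle_measure)" .
  qed
  finally show ?thesis by (simp only: nn_integral_inverse_Icc[OF R])
qed

section \<open>Circle means of the positive logarithm in the Smirnov class\<close>

lemma log_plus_eq: "0 \<le> x \<Longrightarrow> log_plus x = ennreal (ln (max 1 x))"
  by (auto simp: log_plus_def max_def)

lemma poisson_nonneg:
  assumes "norm z \<le> norm \<zeta>"
  shows "0 \<le> poisson z \<zeta>"
proof -
  have "(Re z)\<^sup>2 + (Im z)\<^sup>2 \<le> (Re \<zeta>)\<^sup>2 + (Im \<zeta>)\<^sup>2"
    using assms by (simp add: cmod_def)
  then have "0 \<le> Re (\<zeta> + z) * Re (\<zeta> - z) + Im (\<zeta> + z) * Im (\<zeta> - z)"
    by (simp add: algebra_simps power2_eq_square)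
  then show ?thesis
    unfolding poisson_def Re_divide by (rule divide_nonneg_nonneg) simp
qed

text \<open>For fixed \<zeta> the kernel is the real part of a function of the disc variable that is
  holomorphic and equals 1 at the origin. The average is over the disc variable \<omega>, not over
  \<zeta>, because Tonelli leaves this inner integral below.\<close>

lemma nn_integral_poisson:
  assumes \<zeta>: "norm \<zeta> = 1" and s: "0 \<le> s" "s < 1"
  shows "(\<integral>\<^sup>+\<omega>. ennreal (poisson (of_real s * \<omega>) \<zeta>) \<partial>circle_measure) = 1"
proof -
  let ?F = "\<lambda>\<omega>. (\<zeta> + of_real s * \<omega>) / (\<zeta> - of_real s * \<omega>)"
  have le: "norm (of_real s * \<omega>) \<le> s" if "norm \<omega> \<le> 1" for \<omega> :: complex
    using that s by (simp add: norm_mult mult_left_le)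
  have ne: "\<zeta> - of_real s * \<omega> \<noteq> 0" if "norm \<omega> \<le> 1" for \<omega>
    using le[OF that] \<zeta> s by auto
  have cont: "continuous_on (cball 0 1) ?F" by (intro continuous_intros) (use ne in auto)
  then have conts: "continuous_on (sphere 0 1) ?F" by (rule continuous_on_subset) auto
  have "(\<integral>\<^sup>+\<omega>. ennreal (poisson (of_real s * \<omega>) \<zeta>) \<partial>circle_measure)
      = ennreal (\<integral>\<omega>. poisson (of_real s * \<omega>) \<zeta> \<partial>circle_measure)"
  proof (rule nn_integral_eq_integral)
    show "integrable circle_measure (\<lambda>\<omega>. poisson (of_real s * \<omega>) \<zeta>)"
      unfolding poisson_def by (intro integrable_circle_continuous continuous_intros conts)
    show "AE \<omega> in circle_measure. 0 \<le> poisson (of_real s * \<omega>) \<zeta>"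
    proof (intro AE_I2 poisson_nonneg)
      fix \<omega> assume "\<omega> \<in> space circle_measure"
      then show "norm (of_real s * \<omega>) \<le> norm \<zeta>" using le[of \<omega>] \<zeta> s by simp
    qed
  qed
  also have "(\<integral>\<omega>. poisson (of_real s * \<omega>) \<zeta> \<partial>circle_measure) = Re (\<integral>\<omega>. ?F \<omega> \<partial>circle_measure)"
    unfolding poisson_def by (intro integral_Re integrable_circle_continuous conts)
  also have "(\<integral>\<omega>. ?F \<omega> \<partial>circle_measure) = ?F 0"
    by (intro circle_mean_value cont holomorphic_intros) (use ne in auto)
  finally show ?thesis using \<zeta> by auto
qed

text \<open>Dropping the integral of the negative part of \<open>log |g|\<close> only enlarges the
  majorant, which is then nonnegative; so it also bounds the positive part of
  \<open>log |f|\<close>.\<close>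

lemma smirnov_log_le:
  assumes "smirnov f g" "norm z < 1"
  shows "ennreal (ln (max 1 (norm (f z))))
    \<le> (\<integral>\<^sup>+\<zeta>. log_plus (norm (g \<zeta>)) * ennreal (poisson z \<zeta>) \<partial>circle_measure)" (is "_ \<le> ?A")
proof (cases "norm (f z) \<le> 1")
  case True
  then have "max 1 (norm (f z)) = 1" by simp
  then show ?thesis by simp
next
  case False
  then have "ereal (ln (norm (f z))) \<le> log_poisson_integral g z"
    using assms unfolding smirnov_def by (cases "f z = 0") auto
  \<comment> \<open>This covers the case where both integrals are infinite, since
    \<open>\<infinity> - \<infinity> = \<infinity>\<close> in \<open>ereal\<close>.\<close>
  also have "\<dots> \<le> enn2ereal ?A"
    unfolding log_poisson_integral_def
    by (intro ereal_diff_le_self) simp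
  finally have "enn2ereal (ennreal (ln (norm (f z)))) \<le> enn2ereal ?A"
    using False by (simp add: enn2ereal_ennreal)
  then show ?thesis using False by (simp add: less_eq_ennreal.rep_eq max_def)
qed

text \<open>The pointwise Poisson majorant is averaged over the circle of radius \<open>s\<close>;
  after exchanging the integrals the kernel averages to 1.\<close>

lemma smirnov_circle_mean_log_le:
  assumes f: "smirnov f g" and g [measurable]: "g \<in> borel_measurable circle_measure"
    and s: "0 \<le> s" "s < 1"
  shows "(\<integral>\<^sup>+\<omega>. ennreal (ln (max 1 (norm (f (of_real s * \<omega>))))) \<partial>circle_measure)
    \<le> (\<integral>\<^sup>+\<zeta>. ennreal (ln (max 1 (norm (g \<zeta>)))) \<partial>circle_measure)"
proof -
  interpret pair_sigma_finite circle_measure circle_measure ..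
  let ?L = "\<lambda>\<zeta>. ennreal (ln (max 1 (norm (g \<zeta>))))"
  have "(\<integral>\<^sup>+\<omega>. ennreal (ln (max 1 (norm (f (of_real s * \<omega>))))) \<partial>circle_measure)
    \<le> (\<integral>\<^sup>+\<omega>. (\<integral>\<^sup>+\<zeta>. ?L \<zeta> * ennreal (poisson (of_real s * \<omega>) \<zeta>) \<partial>circle_measure) \<partial>circle_measure)"
  proof (intro nn_integral_mono)
    fix \<omega> assume "\<omega> \<in> space circle_measure"
    then have "norm (of_real s * \<omega>) < 1" using s by (simp add: norm_mult)
    from smirnov_log_le[OF f this]
    show "ennreal (ln (max 1 (norm (f (of_real s * \<omega>)))))
      \<le> (\<integral>\<^sup>+\<zeta>. ?L \<zeta> * ennreal (poisson (of_real s * \<omega>) \<zeta>) \<partial>circle_measure)"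
      by (simp add: log_plus_eq)
  qed
  also have "\<dots> = (\<integral>\<^sup>+\<zeta>. (\<integral>\<^sup>+\<omega>. ?L \<zeta> * ennreal (poisson (of_real s * \<omega>) \<zeta>) \<partial>circle_measure) \<partial>circle_measure)"
    by (rule Fubini'[symmetric]) (simp add: poisson_def)
  also have "\<dots> = (\<integral>\<^sup>+\<zeta>. ?L \<zeta> \<partial>circle_measure)"
  proof (intro nn_integral_cong)
    fix \<zeta> assume "\<zeta> \<in> space circle_measure"
    then have \<zeta>: "norm \<zeta> = 1" by simp
    have "(\<integral>\<^sup>+\<omega>. ?L \<zeta> * ennreal (poisson (of_real s * \<omega>) \<zeta>) \<partial>circle_measure)
        = ?L \<zeta> * (\<integral>\<^sup>+\<omega>. ennreal (poisson (of_real s * \<omega>) \<zeta>) \<partial>circle_measure)"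
      by (intro nn_integral_cmult) (simp add: poisson_def)
    then show "(\<integral>\<^sup>+\<omega>. ?L \<zeta> * ennreal (poisson (of_real s * \<omega>) \<zeta>) \<partial>circle_measure) = ?L \<zeta>"
      using nn_integral_poisson[OF \<zeta> s] by simp
  qed
  finally show ?thesis .
qed

text \<open>A radius lies in the region of aperture 2, because
  \<open>norm (\<zeta> - s * \<zeta>) = 1 - s\<close> is less than
  \<open>2 * (1 - s)\<close>.\<close>

lemma nontangential_limit_radial:
  assumes "nontangential_limit f \<zeta> L" "norm \<zeta> = 1"
    and s: "\<And>n. 0 \<le> s n" "\<And>n. s n < 1" "s \<longlonglongrightarrow> 1"
  shows "(\<lambda>n. f (of_real (s n) * \<zeta>)) \<longlonglongrightarrow> L"
proof -
  have "(f \<longlongrightarrow> L) (at \<zeta> within stolz 2 \<zeta>)"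
    using assms(1) by (simp add: nontangential_limit_def)
  moreover have "filterlim (\<lambda>n. of_real (s n) * \<zeta>) (at \<zeta> within stolz 2 \<zeta>) sequentially"
    unfolding filterlim_at
  proof (intro conjI always_eventually allI)
    have "(\<lambda>n. of_real (s n) * \<zeta>) \<longlonglongrightarrow> of_real 1 * \<zeta>"
      by (intro tendsto_intros s)
    then show "(\<lambda>n. of_real (s n) * \<zeta>) \<longlonglongrightarrow> \<zeta>" by simp
    fix n
    have 1: "norm (of_real (s n) * \<zeta>) = s n" using s assms(2) by (simp add: norm_mult)
    have "\<zeta> - of_real (s n) * \<zeta> = of_real (1 - s n) * \<zeta>" by (simp add: algebra_simps)
    then have 2: "norm (\<zeta> - of_real (s n) * \<zeta>) = 1 - s n"
      using s(2)[of n] assms(2) by (simp only: norm_mult norm_of_real) simp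
    show "of_real (s n) * \<zeta> \<in> stolz 2 \<zeta>"
      unfolding stolz_def mem_Collect_eq 1 2 using s(2)[of n] by simp
    show "of_real (s n) * \<zeta> \<noteq> \<zeta>"
      using 1 s(2)[of n] assms(2) by auto
  qed
  ultimately show ?thesis by (rule filterlim_compose)
qed

section \<open>Dilations and Fatou's lemma for their circle means\<close>

lemma dilation_cball_subset_ball:
  assumes "0 \<le> s" "s < 1"
  shows "(\<lambda>z::complex. of_real s * z) ` cball 0 1 \<subseteq> ball 0 1"
proof safe
  fix z :: complex assume "z \<in> cball 0 1"
  then have "s * norm z \<le> s * 1" using assms by (intro mult_left_mono) auto
  then show "of_real s * z \<in> ball 0 1" using assms by (simp add: norm_mult)
qed

lemma continuous_on_dilation:
  assumes "f holomorphic_on ball 0 1" "0 \<le> s" "s < 1"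
  shows "continuous_on (cball 0 1) (\<lambda>z. f (of_real s * z))"
  by (rule continuous_on_compose2[OF holomorphic_on_imp_continuous_on[OF assms(1)] _
        dilation_cball_subset_ball[OF assms(2,3)]]) (intro continuous_intros)

lemma holomorphic_on_dilation:
  assumes "f holomorphic_on ball 0 1" "0 \<le> s" "s < 1"
  shows "(\<lambda>z. f (of_real s * z)) holomorphic_on ball 0 1"
proof (rule holomorphic_on_compose_gen[OF _ assms(1), unfolded o_def])
  show "(\<lambda>z::complex. of_real s * z) ` ball 0 1 \<subseteq> ball 0 1"
    by (rule order_trans[OF image_mono[OF ball_subset_cball] dilation_cball_subset_ball[OF assms(2,3)]])
qed (intro holomorphic_intros)

text \<open>In \<open>H = R + 3 * R * l - \<Phi>\<close> the function \<Phi> enters with a minus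
  sign, so Fatou's lower semicontinuity for \<open>H \<ge> 0\<close> becomes an upper bound for
  means of \<Phi> inside the disc. The means of \<open>l\<close> along the dilations do not exceed
  \<open>L\<close> by the Smirnov condition, and the mean \<open>I\<close> on the inner circle is at
  most every mean of \<Phi> farther out. On the circle of radius \<open>r\<close> the truncation is
  inactive because \<open>norm f \<le> R\<close> there.\<close>

lemma circle_mean_abs_Re_le_truncated:
  assumes f: "f holomorphic_on ball 0 1" and g [measurable]: "g \<in> borel_measurable circle_measure"
    and lim: "AE \<zeta> in circle_measure. nontangential_limit f \<zeta> (g \<zeta>)"
    and smir: "smirnov f g"
    and fin: "(\<integral>\<^sup>+\<zeta>. ennreal (ln (max 1 (norm (g \<zeta>)))) \<partial>circle_measure) < \<infinity>"
    and R: "1 \<le> R" and r: "0 \<le> r" "r < 1"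
    and bound: "\<And>\<zeta>. norm \<zeta> = 1 \<Longrightarrow> norm (f (of_real r * \<zeta>)) \<le> R"
  shows "(\<integral>\<zeta>. \<bar>Re (f (of_real r * \<zeta>))\<bar> \<partial>circle_measure)
    \<le> (\<integral>\<zeta>. truncated_abs_Re R (g \<zeta>) \<partial>circle_measure)"
    and "integrable circle_measure (\<lambda>\<zeta>. truncated_abs_Re R (g \<zeta>))"
proof -
  define \<Phi> where "\<Phi> = truncated_abs_Re R"
  define l where "l w = ln (max 1 (norm w))" for w :: complex
  define H where "H w = R + 3 * R * l w - \<Phi> w" for w
  \<comment> \<open>Radii increasing to 1 from \<open>s 0 = r\<close>, so that the circle of radius
    \<open>r\<close> is never outside the one of radius \<open>s n\<close>.\<close>
  define s where "s n = 1 - (1 - r) / (real n + 1)" for n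
  define I where "I = (\<integral>\<zeta>. \<bar>Re (f (of_real r * \<zeta>))\<bar> \<partial>circle_measure)"
  define L where "L = (\<integral>\<zeta>. l (g \<zeta>) \<partial>circle_measure)"
  have l0: "0 \<le> l w" for w by (simp add: l_def)
  have H0: "0 \<le> H w" for w
    using truncated_abs_Re_le_log_growth[OF R, of w] by (simp add: H_def \<Phi>_def l_def)
  have \<Phi>0: "0 \<le> \<Phi> w" for w using truncated_abs_Re_nonneg R by (simp add: \<Phi>_def)
  have s: "0 \<le> s n" "s n < 1" "r \<le> s n" for n
  proof -
    have "(1 - r) / (real n + 1) \<le> (1 - r) / 1" using r by (intro divide_left_mono) auto
    then show "r \<le> s n" by (simp add: s_def)
    then show "0 \<le> s n" using r by simp
    show "s n < 1" using r by (simp add: s_def add_pos_nonneg)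
  qed
  have slim: "s \<longlonglongrightarrow> 1"
  proof -
    have "(\<lambda>n. 1 - (1 - r) * inverse (real (Suc n))) \<longlonglongrightarrow> 1 - (1 - r) * 0"
      by (intro tendsto_intros LIMSEQ_inverse_real_of_nat)
    then show ?thesis by (simp add: s_def[abs_def] divide_inverse add.commute)
  qed
  have \<Phi>c: "continuous_on UNIV \<Phi>" unfolding \<Phi>_def using R by (intro continuous_on_truncated_abs_Re) simp
  have lc: "continuous_on UNIV l" unfolding l_def by (intro continuous_intros) auto
  have Hc: "continuous_on UNIV H" unfolding H_def by (intro continuous_intros \<Phi>c lc)
  note [measurable] = borel_measurable_continuous_onI[OF \<Phi>c] borel_measurable_continuous_onI[OF lc]
    borel_measurable_continuous_onI[OF Hc]
  have fs: "continuous_on (sphere 0 1) (\<lambda>\<zeta>. f (of_real (s n) * \<zeta>))" for n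
    by (rule continuous_on_subset[OF continuous_on_dilation[OF f s(1,2)]]) auto
  note [measurable] = borel_measurable_circle_continuous[OF fs]
  have int_l: "integrable circle_measure (\<lambda>\<zeta>. l (g \<zeta>))"
    using fin l0 by (intro integrableI_nonneg) (auto simp: l_def)
  have int_\<Phi>: "integrable circle_measure (\<lambda>\<zeta>. \<Phi> (g \<zeta>))"
  proof (rule Bochner_Integration.integrable_bound)
    show "integrable circle_measure (\<lambda>\<zeta>. R + 3 * R * l (g \<zeta>))"
      using int_l by simp
    show "AE \<zeta> in circle_measure. norm (\<Phi> (g \<zeta>)) \<le> norm (R + 3 * R * l (g \<zeta>))"
      using H0 \<Phi>0 l0 R by (intro AE_I2) (simp add: H_def)
  qed measurable
  then show "integrable circle_measure (\<lambda>\<zeta>. truncated_abs_Re R (g \<zeta>))" by (simp add: \<Phi>_def)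
  have ls: "continuous_on (sphere 0 1) (\<lambda>\<zeta>. l (f (of_real (s n) * \<zeta>)))" for n
    by (rule continuous_on_compose2[OF lc fs]) auto
  have \<Phi>s: "continuous_on (sphere 0 1) (\<lambda>\<zeta>. \<Phi> (f (of_real (s n) * \<zeta>)))" for n
    by (rule continuous_on_compose2[OF \<Phi>c fs]) auto
  have I_le: "I \<le> (\<integral>\<zeta>. \<Phi> (f (of_real (s n) * \<zeta>)) \<partial>circle_measure)" for n
  proof -
    \<comment> \<open>The dilated function is continuous up to the unit circle, and the circle of
      radius \<open>r\<close> becomes that of radius \<open>r / s n\<close>.\<close>
    let ?F = "\<lambda>z. \<Phi> (f (of_real (s n) * z))"
    have "I = (\<integral>\<zeta>. ?F (of_real (r / s n) * \<zeta>) \<partial>circle_measure)"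
      unfolding I_def
    proof (intro Bochner_Integration.integral_cong refl)
      fix \<zeta> assume "\<zeta> \<in> space circle_measure"
      \<comment> \<open>If \<open>s n = 0\<close>, then \<open>r = 0\<close> because
        \<open>r \<le> s n\<close>, and the identity holds with division by zero giving 0.\<close>
      moreover have "s n * (r / s n) = r" using s(3)[of n] r by (cases "s n = 0") auto
      then have "of_real (s n) * (of_real (r / s n) * \<zeta>) = of_real r * \<zeta>"
        by (metis mult.assoc of_real_mult)
      then have "?F (of_real (r / s n) * \<zeta>) = \<Phi> (f (of_real r * \<zeta>))"
        by (simp only:)
      ultimately show "\<bar>Re (f (of_real r * \<zeta>))\<bar> = ?F (of_real (r / s n) * \<zeta>)"
        using bound[of \<zeta>] R by (simp add: \<Phi>_def truncated_abs_Re_inside)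
    qed
    also have "\<dots> \<le> (\<integral>\<zeta>. ?F \<zeta> \<partial>circle_measure)"
    proof (rule locally_touched_below_circle_mean_mono[where F = ?F])
      show "continuous_on (cball 0 1) ?F"
        by (rule continuous_on_compose2[OF \<Phi>c continuous_on_dilation[OF f s(1,2)]]) auto
      show "locally_touched_below (ball 0 1) ?F"
        unfolding \<Phi>_def using R
        by (intro locally_touched_below_truncated_abs_Re holomorphic_on_dilation f s) auto
      show "0 \<le> r / s n" using r s by simp
      show "r / s n \<le> 1" using s(1,3)[of n] by (auto simp: divide_le_eq_1)
    qed
    finally show ?thesis .
  qed
  have L_ge: "(\<integral>\<zeta>. l (f (of_real (s n) * \<zeta>)) \<partial>circle_measure) \<le> L" for n
  proof -
    have "ennreal (\<integral>\<zeta>. l (f (of_real (s n) * \<zeta>)) \<partial>circle_measure)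
        = (\<integral>\<^sup>+\<zeta>. ennreal (l (f (of_real (s n) * \<zeta>))) \<partial>circle_measure)"
      using l0 by (intro nn_integral_eq_integral[symmetric] integrable_circle_continuous ls) auto
    also have "\<dots> \<le> (\<integral>\<^sup>+\<zeta>. ennreal (l (g \<zeta>)) \<partial>circle_measure)"
      unfolding l_def by (rule smirnov_circle_mean_log_le[OF smir g s(1,2)])
    also have "\<dots> = ennreal L"
      unfolding L_def using l0 by (intro nn_integral_eq_integral int_l) auto
    finally show ?thesis
      using l0 by (subst (asm) ennreal_le_iff) (auto simp: L_def)
  qed
  have H_le: "(\<integral>\<^sup>+\<zeta>. ennreal (H (f (of_real (s n) * \<zeta>))) \<partial>circle_measure) \<le> ennreal (R + 3 * R * L - I)" for n
  proof -
    have i1: "integrable circle_measure (\<lambda>\<zeta>. l (f (of_real (s n) * \<zeta>)))"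
      by (rule integrable_circle_continuous[OF ls])
    have i2: "integrable circle_measure (\<lambda>\<zeta>. \<Phi> (f (of_real (s n) * \<zeta>)))"
      by (rule integrable_circle_continuous[OF \<Phi>s])
    have "(\<integral>\<^sup>+\<zeta>. ennreal (H (f (of_real (s n) * \<zeta>))) \<partial>circle_measure)
        = ennreal (\<integral>\<zeta>. H (f (of_real (s n) * \<zeta>)) \<partial>circle_measure)"
      using H0 i1 i2 by (intro nn_integral_eq_integral) (auto simp: H_def)
    also have "(\<integral>\<zeta>. H (f (of_real (s n) * \<zeta>)) \<partial>circle_measure)
        = R + 3 * R * (\<integral>\<zeta>. l (f (of_real (s n) * \<zeta>)) \<partial>circle_measure)
          - (\<integral>\<zeta>. \<Phi> (f (of_real (s n) * \<zeta>)) \<partial>circle_measure)"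
      unfolding H_def using i1 i2 by simp
    also have "\<dots> \<le> R + 3 * R * L - I"
      using L_ge[of n] I_le[of n] R by (intro diff_mono add_left_mono mult_left_mono) auto
    finally show ?thesis by (simp add: ennreal_leI)
  qed
  have int_H: "integrable circle_measure (\<lambda>\<zeta>. H (g \<zeta>))"
    unfolding H_def using int_l int_\<Phi> by simp
  have "ennreal (\<integral>\<zeta>. H (g \<zeta>) \<partial>circle_measure) = (\<integral>\<^sup>+\<zeta>. ennreal (H (g \<zeta>)) \<partial>circle_measure)"
    using H0 by (intro nn_integral_eq_integral[symmetric] int_H) auto
  also have "\<dots> = (\<integral>\<^sup>+\<zeta>. liminf (\<lambda>n. ennreal (H (f (of_real (s n) * \<zeta>)))) \<partial>circle_measure)"
  proof (rule nn_integral_cong_AE)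
    have "AE \<zeta> in circle_measure. \<zeta> \<in> space circle_measure" by (rule AE_space)
    with lim show "AE \<zeta> in circle_measure. ennreal (H (g \<zeta>)) = liminf (\<lambda>n. ennreal (H (f (of_real (s n) * \<zeta>))))"
    proof eventually_elim
      case (elim \<zeta>)
      have "(\<lambda>n. f (of_real (s n) * \<zeta>)) \<longlonglongrightarrow> g \<zeta>"
        by (rule nontangential_limit_radial[OF elim(1)]) (use elim(2) s slim in auto)
      then have "(\<lambda>n. H (f (of_real (s n) * \<zeta>))) \<longlonglongrightarrow> H (g \<zeta>)"
        by (rule continuous_on_tendsto_compose[OF Hc]) auto
      then have "(\<lambda>n. ennreal (H (f (of_real (s n) * \<zeta>)))) \<longlonglongrightarrow> ennreal (H (g \<zeta>))"
        by (rule tendsto_ennrealI)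
      then show ?case by (rule lim_imp_Liminf[OF sequentially_bot, symmetric])
    qed
  qed
  also have "\<dots> \<le> liminf (\<lambda>n. \<integral>\<^sup>+\<zeta>. ennreal (H (f (of_real (s n) * \<zeta>))) \<partial>circle_measure)"
    by (rule nn_integral_liminf) measurable
  also have "\<dots> \<le> ennreal (R + 3 * R * L - I)"
  proof -
    have "liminf (\<lambda>n. \<integral>\<^sup>+\<zeta>. ennreal (H (f (of_real (s n) * \<zeta>))) \<partial>circle_measure)
        \<le> liminf (\<lambda>n. ennreal (R + 3 * R * L - I))"
      by (intro Liminf_mono always_eventually allI H_le)
    then show ?thesis by (simp add: Liminf_const)
  qed
  finally have *: "ennreal (\<integral>\<zeta>. H (g \<zeta>) \<partial>circle_measure) \<le> ennreal (R + 3 * R * L - I)" .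
  \<comment> \<open>\<open>ennreal\<close> sends negative numbers to 0, so the comparison returns to
    the reals only once this bound is known to be nonnegative; the mean of \<open>H\<close> for the
    first dilation shows it.\<close>
  have "0 \<le> R + 3 * R * L - I"
  proof -
    have "0 \<le> (\<integral>\<zeta>. H (f (of_real (s 0) * \<zeta>)) \<partial>circle_measure)"
      using H0 by simp
    also have "\<dots> = R + 3 * R * (\<integral>\<zeta>. l (f (of_real (s 0) * \<zeta>)) \<partial>circle_measure)
          - (\<integral>\<zeta>. \<Phi> (f (of_real (s 0) * \<zeta>)) \<partial>circle_measure)"
      unfolding H_def
      using integrable_circle_continuous[OF ls[of 0]] integrable_circle_continuous[OF \<Phi>s[of 0]] by simp
    also have "\<dots> \<le> R + 3 * R * L - I"
      using L_ge[of 0] I_le[of 0] R by (intro diff_mono add_left_mono mult_left_mono) auto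
    finally show ?thesis .
  qed
  with * have "(\<integral>\<zeta>. H (g \<zeta>) \<partial>circle_measure) \<le> R + 3 * R * L - I"
    by (subst (asm) ennreal_le_iff) auto
  moreover have "(\<integral>\<zeta>. H (g \<zeta>) \<partial>circle_measure) = R + 3 * R * L - (\<integral>\<zeta>. \<Phi> (g \<zeta>) \<partial>circle_measure)"
    unfolding H_def L_def using int_l int_\<Phi> by simp
  ultimately show "I \<le> (\<integral>\<zeta>. truncated_abs_Re R (g \<zeta>) \<partial>circle_measure)"
    by (simp add: \<Phi>_def)
qed

text \<open>A finite liminf forces a finite tail integral for at least one \<open>R \<ge> 1\<close>,
  as otherwise \<open>R * T R\<close> would be constantly infinite from 1 on. For this
  \<open>R\<close>, the positive part of \<open>log |g|\<close> is at most \<open>log R\<close> plus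
  the positive part of \<open>log (|g| / R)\<close>.\<close>

lemma tail_liminf_finite_imp_log_integrable:
  assumes g [measurable]: "g \<in> borel_measurable circle_measure" and fin: "tail_liminf g < \<infinity>"
  shows "(\<integral>\<^sup>+\<zeta>. ennreal (ln (max 1 (norm (g \<zeta>)))) \<partial>circle_measure) < \<infinity>"
proof -
  define T where "T R = (\<integral>\<^sup>+ t\<in>{R..}. ennreal (distrib_fun g t / t) \<partial>lborel)" for R :: real
  have "\<exists>R\<ge>1. T R < \<infinity>"
  proof (rule ccontr)
    assume "\<not> ?thesis"
    then have inf: "T R = \<infinity>" if "1 \<le> R" for R
      using that by (auto simp: not_less top_unique)
    have "\<infinity> \<le> tail_liminf g"
      unfolding tail_liminf_def T_def[symmetric]
    proof (rule Liminf_bounded)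
      show "\<forall>\<^sub>F R in at_top. \<infinity> \<le> ennreal R * T R"
        using eventually_ge_at_top[of 1]
        by eventually_elim (simp add: inf ennreal_mult_top)
    qed
    with fin show False by simp
  qed
  then obtain R where R: "1 \<le> R" "T R < \<infinity>" by blast
  have "(\<integral>\<^sup>+\<zeta>. ennreal (ln (max 1 (norm (g \<zeta>)))) \<partial>circle_measure)
      \<le> (\<integral>\<^sup>+\<zeta>. ennreal (ln R) + ennreal (ln (max R (norm (g \<zeta>)) / R)) \<partial>circle_measure)"
  proof (intro nn_integral_mono)
    fix \<zeta>
    have "ln (max 1 (norm (g \<zeta>))) \<le> ln (max R (norm (g \<zeta>)))"
      using R by (subst ln_le_cancel_iff) auto
    also have "\<dots> = ln R + ln (max R (norm (g \<zeta>)) / R)"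
      using R by (subst ln_div) auto
    finally have "ennreal (ln (max 1 (norm (g \<zeta>)))) \<le> ennreal (ln R + ln (max R (norm (g \<zeta>)) / R))"
      by (rule ennreal_leI)
    also have "\<dots> = ennreal (ln R) + ennreal (ln (max R (norm (g \<zeta>)) / R))"
      using R by (intro ennreal_plus) auto
    finally show "ennreal (ln (max 1 (norm (g \<zeta>)))) \<le> ennreal (ln R) + ennreal (ln (max R (norm (g \<zeta>)) / R))" .
  qed
  also have "\<dots> = ennreal (ln R) + T R"
    unfolding T_def using R
    by (subst nn_integral_add)
       (auto simp: tail_integral_eq_log_integral circle.emeasure_space_1[simplified])
  also have "\<dots> < \<infinity>" using R by simp
  finally show ?thesis .
qed

text \<open>Once \<open>R\<close> is at least 1 and exceeds the bound \<open>B\<close> of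
  \<open>f\<close> on the closed disc of radius \<open>r\<close>, the truncated estimate reads
  \<open>A \<le> N + 3 * R * T R\<close>. Here \<open>A\<close> and \<open>N\<close> do not depend
  on \<open>R\<close>, so \<open>(A - N) / 3\<close> is an eventual lower bound of
  \<open>R * T R\<close>, hence of its liminf.\<close>

lemma circle_mean_abs_Re_le:
  assumes f: "f holomorphic_on ball 0 1" and g [measurable]: "g \<in> borel_measurable circle_measure"
    and lim: "AE \<zeta> in circle_measure. nontangential_limit f \<zeta> (g \<zeta>)"
    and smir: "smirnov f g"
    and int: "integrable circle_measure (\<lambda>\<zeta>. Re (g \<zeta>))"
    and fin: "tail_liminf g < \<infinity>"
    and r: "0 \<le> r" "r < 1"
  shows "(\<integral>\<zeta>. \<bar>Re (f (of_real r * \<zeta>))\<bar> \<partial>circle_measure)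
    \<le> (\<integral>\<zeta>. \<bar>Re (g \<zeta>)\<bar> \<partial>circle_measure) + 3 * enn2real (tail_liminf g)"
proof -
  define A where "A = (\<integral>\<zeta>. \<bar>Re (f (of_real r * \<zeta>))\<bar> \<partial>circle_measure)"
  define N where "N = (\<integral>\<zeta>. \<bar>Re (g \<zeta>)\<bar> \<partial>circle_measure)"
  define T where "T R = (\<integral>\<^sup>+ t\<in>{R..}. ennreal (distrib_fun g t / t) \<partial>lborel)" for R :: real
  have "compact ((\<lambda>\<zeta>. f (of_real r * \<zeta>)) ` cball 0 1)"
    by (rule compact_continuous_image[OF continuous_on_dilation[OF f r] compact_cball])
  from compact_imp_bounded[OF this]
  obtain B where B: "\<And>\<zeta>. \<zeta> \<in> cball 0 1 \<Longrightarrow> norm (f (of_real r * \<zeta>)) \<le> B"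
    unfolding bounded_iff Set.ball_simps(9) by blast
  have "ennreal ((A - N) / 3) \<le> tail_liminf g"
    unfolding tail_liminf_def T_def[symmetric]
  proof (rule Liminf_bounded)
    show "\<forall>\<^sub>F R in at_top. ennreal ((A - N) / 3) \<le> ennreal R * T R"
      using eventually_ge_at_top[of "max 1 B"]
    proof eventually_elim
      case (elim R)
      then have R: "1 \<le> R" "B \<le> R" by auto
      have bound: "norm (f (of_real r * \<zeta>)) \<le> R" if "norm \<zeta> = 1" for \<zeta>
        using B[of \<zeta>] that R by simp
      note tr = circle_mean_abs_Re_le_truncated[OF f g lim smir
          tail_liminf_finite_imp_log_integrable[OF g fin] R(1) r bound]
      have "ennreal A \<le> ennreal (\<integral>\<zeta>. truncated_abs_Re R (g \<zeta>) \<partial>circle_measure)"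
        unfolding A_def by (intro ennreal_leI tr(1))
      also have "\<dots> = (\<integral>\<^sup>+\<zeta>. ennreal (truncated_abs_Re R (g \<zeta>)) \<partial>circle_measure)"
        using R by (intro nn_integral_eq_integral[symmetric] tr(2) AE_I2 truncated_abs_Re_nonneg) auto
      also have "\<dots> \<le> (\<integral>\<^sup>+\<zeta>. ennreal \<bar>Re (g \<zeta>)\<bar> + ennreal (3 * R) * ennreal (ln (max R (norm (g \<zeta>)) / R)) \<partial>circle_measure)"
      proof (intro nn_integral_mono)
        fix \<zeta>
        have "ennreal (truncated_abs_Re R (g \<zeta>)) \<le> ennreal (\<bar>Re (g \<zeta>)\<bar> + 3 * R * ln (max R (norm (g \<zeta>)) / R))"
          using R by (intro ennreal_leI truncated_abs_Re_le) auto
        also have "\<dots> = ennreal \<bar>Re (g \<zeta>)\<bar> + ennreal (3 * R) * ennreal (ln (max R (norm (g \<zeta>)) / R))"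
          using R by (simp add: ennreal_plus ennreal_mult)
        finally show "ennreal (truncated_abs_Re R (g \<zeta>)) \<le> ennreal \<bar>Re (g \<zeta>)\<bar> + ennreal (3 * R) * ennreal (ln (max R (norm (g \<zeta>)) / R))" .
      qed
      also have "\<dots> = (\<integral>\<^sup>+\<zeta>. ennreal \<bar>Re (g \<zeta>)\<bar> \<partial>circle_measure) + ennreal (3 * R) * T R"
        unfolding T_def using R
        by (subst nn_integral_add) (auto simp: tail_integral_eq_log_integral nn_integral_cmult)
      also have "(\<integral>\<^sup>+\<zeta>. ennreal \<bar>Re (g \<zeta>)\<bar> \<partial>circle_measure) = ennreal N"
        unfolding N_def using int by (intro nn_integral_eq_integral) auto
      finally have le: "ennreal A \<le> ennreal N + ennreal (3 * R) * T R" .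
      show ?case
      proof (cases "T R")
        case (real t)
        have N0: "0 \<le> N" by (simp add: N_def)
        have "ennreal A \<le> ennreal (N + 3 * R * t)"
          using le real R N0 by (simp add: ennreal_mult ennreal_plus)
        then have "A \<le> N + 3 * R * t"
          using real R N0 by (subst (asm) ennreal_le_iff) auto
        then have "ennreal ((A - N) / 3) \<le> ennreal (R * t)"
          by (intro ennreal_leI) simp
        then show ?thesis using real R by (simp add: ennreal_mult)
      next
        case top
        then show ?thesis using R by (simp add: ennreal_mult_top)
      qed
    qed
  qed
  then have "enn2real (ennreal ((A - N) / 3)) \<le> enn2real (tail_liminf g)"
    using fin by (intro enn2real_mono) auto
  \<comment> \<open>Only an inequality, since a negative \<open>A - N\<close> is turned into 0 by
    \<open>ennreal\<close>.\<close>
  moreover have "(A - N) / 3 \<le> enn2real (ennreal ((A - N) / 3))"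
    by (cases "0 \<le> (A - N) / 3") (simp, simp add: ennreal_neg)
  ultimately have "(A - N) / 3 \<le> enn2real (tail_liminf g)"
    by (rule order_trans[rotated])
  then show ?thesis
    unfolding A_def[symmetric] N_def[symmetric] by (simp add: field_simps)
qed

section \<open>Weak compactness and the representation\<close>

lemma isCont_circle_cutoff:
  fixes \<phi> :: "complex \<Rightarrow> 'a::real_normed_vector"
  assumes "continuous_on (sphere 0 1) \<phi>"
  shows "isCont (\<lambda>t. max 0 (min 1 (8 - t)) *\<^sub>R \<phi> (cis t)) x"
proof -
  have "continuous_on UNIV (\<lambda>t. max 0 (min 1 (8 - t)) *\<^sub>R \<phi> (cis t))"
    by (intro continuous_intros continuous_on_compose2[OF assms]) auto
  then show ?thesis by (simp add: continuous_on_eq_continuous_at)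
qed

text \<open>The densities are transported to \<open>[0, 2\<pi>]\<close> and completed to probability measures by a
  mass on \<open>[10, 11]\<close>, which the cutoff \<open>max 0 (min 1 (8 - t))\<close> removes again after the
  passage to the limit.\<close>

lemma circle_densities_weakly_compact:
  fixes W :: "nat \<Rightarrow> complex \<Rightarrow> real"
  assumes int: "\<And>n. integrable circle_measure (W n)"
    and nonneg: "\<And>n \<zeta>. 0 \<le> W n \<zeta>"
    and mass: "\<And>n. (\<integral>\<zeta>. W n \<zeta> \<partial>circle_measure) \<le> M"
  obtains k \<sigma> where "strict_mono (k :: nat \<Rightarrow> nat)" "sets \<sigma> = sets circle_measure" "finite_measure \<sigma>"
    "\<And>\<phi> :: complex \<Rightarrow> complex. continuous_on (sphere 0 1) \<phi> \<Longrightarrow>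
       (\<lambda>n. \<integral>\<zeta>. of_real (W (k n) \<zeta>) * \<phi> \<zeta> \<partial>circle_measure) \<longlonglongrightarrow> (\<integral>\<zeta>. \<phi> \<zeta> \<partial>\<sigma>)"
proof -
  \<comment> \<open>A positive bound for the masses, so that dividing by it is a legitimate
    normalization even for \<open>M = 0\<close>.\<close>
  define M' where "M' = max M 1"
  have M': "0 < M'" "M \<le> M'" by (auto simp: M'_def)
  define v where "v n t = indicator {0..2*pi} t / (2*pi) * W n (cis t)" for n t
  define a where "a n = (\<integral>\<zeta>. W n \<zeta> \<partial>circle_measure)" for n
  define d where "d n t = v n t / M' + (1 - a n / M') * indicator {10..11} t" for n t
  define P where "P n = density lborel (\<lambda>t. ennreal (d n t))" for n
  \<comment> \<open>Equal to 1 up to 7, hence on \<open>{0..2*pi}\<close>, and equal to 0 from 8 on,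
    hence on \<open>{10..11}\<close>.\<close>
  define \<kappa> :: "real \<Rightarrow> real" where "\<kappa> t = max 0 (min 1 (8 - t))" for t
  have meas: "W n \<in> borel_measurable circle_measure" for n using int by auto
  have int_v: "integrable lborel (v n)" and a_eq: "a n = (\<integral>t. v n t \<partial>lborel)" for n
    using integral_circle_measure[OF meas[of n]] int[of n] unfolding v_def[abs_def] a_def by auto
  have [measurable]: "v n \<in> borel_measurable lborel" for n using int_v by auto
  have v0: "0 \<le> v n t" for n t using nonneg by (simp add: v_def)
  have a: "0 \<le> a n" "a n \<le> M'" for n
    using mass[of n] M' nonneg by (auto simp: a_def intro: order_trans)
  have d0: "0 \<le> d n t" for n t
    unfolding d_def using v0 a M' by (intro add_nonneg_nonneg mult_nonneg_nonneg) (auto simp: field_simps)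
  have d_supp: "d n t = 0" if "t \<notin> {-1<..11}" for n t
    using that pi_less_4 by (auto simp: d_def v_def split: split_indicator)
  have [measurable]: "d n \<in> borel_measurable lborel" for n unfolding d_def[abs_def] by measurable
  have int_d: "integrable lborel (d n)" for n
    unfolding d_def[abs_def] using int_v by auto
  have int1: "(\<integral>t. d n t \<partial>lborel) = 1" for n
    unfolding d_def using int_v[of n] M' by (simp add: a_eq[symmetric])
  have nn1: "(\<integral>\<^sup>+t. ennreal (d n t) \<partial>lborel) = 1" for n
    using nn_integral_eq_integral[OF int_d[of n]] d0 int1[of n] by simp
  have dist: "real_distribution (P n)" for n
  proof (intro real_distribution.intro prob_spaceI real_distribution_axioms.intro)
    show "emeasure (P n) (space (P n)) = 1"
      unfolding P_def using nn1[of n] by (subst emeasure_density) auto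
  qed (simp_all add: P_def)
  have "tight P"
    unfolding tight_def
  proof (intro conjI allI impI dist)
    fix e :: real assume e: "0 < e"
    \<comment> \<open>Tightness is phrased with half-open intervals, so the left end lies below 0 in
      order to contain the whole support.\<close>
    have "measure (P n) {-1<..11} = 1" for n
    proof -
      have "emeasure (P n) {-1<..11} = (\<integral>\<^sup>+t. ennreal (d n t) * indicator {-1<..11} t \<partial>lborel)"
        unfolding P_def by (subst emeasure_density) auto
      also have "\<dots> = (\<integral>\<^sup>+t. ennreal (d n t) \<partial>lborel)"
        using d_supp by (intro nn_integral_cong) (auto split: split_indicator)
      finally show ?thesis using nn1[of n] by (simp add: measure_def)
    qed
    then show "\<exists>a b. a < b \<and> (\<forall>n. 1 - e < measure (P n) {a<..b})"
      using e by (intro exI[of _ "-1"] exI[of _ 11]) auto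
  qed
  from tight_imp_convergent_subsubsequence[OF this strict_mono_id]
  obtain k Q where k: "strict_mono k" and Q: "real_distribution Q" and "weak_conv_m (P \<circ> id \<circ> k) Q"
    by blast
  then have conv: "weak_conv_m (\<lambda>n. P (k n)) Q" by (simp add: o_def)
  interpret Q: real_distribution Q by (rule Q)
  \<comment> \<open>The factor \<open>M'\<close> undoes the normalization, \<kappa> removes the
    auxiliary mass, and \<open>cis\<close> carries the result back to the circle.\<close>
  define \<sigma> where "\<sigma> = distr (density Q (\<lambda>t. ennreal (M' * \<kappa> t))) (restrict_space borel (sphere 0 1)) cis"
  have \<kappa>: "0 \<le> \<kappa> t" "\<kappa> t \<le> 1" for t by (auto simp: \<kappa>_def)
  have [measurable]: "\<kappa> \<in> borel_measurable borel" unfolding \<kappa>_def[abs_def] by measurable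
  show thesis
  proof (rule that[OF k, of \<sigma>])
    show "sets \<sigma> = sets circle_measure" by (simp add: \<sigma>_def sets_circle_measure)
    show "finite_measure \<sigma>"
      unfolding \<sigma>_def
    proof (rule finite_measure.finite_measure_distr)
      show "finite_measure (density Q (\<lambda>t. ennreal (M' * \<kappa> t)))"
      proof
        have "(\<integral>\<^sup>+t. ennreal (M' * \<kappa> t) \<partial>Q) \<le> (\<integral>\<^sup>+t. ennreal M' \<partial>Q)"
          using \<kappa> M' by (intro nn_integral_mono ennreal_leI) (auto simp: mult_left_le)
        also have "\<dots> < \<infinity>" using Q.emeasure_space_1 by (simp add: ennreal_mult_less_top)
        finally show "emeasure (density Q (\<lambda>t. ennreal (M' * \<kappa> t))) (space (density Q (\<lambda>t. ennreal (M' * \<kappa> t)))) \<noteq> \<infinity>"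
          by (subst emeasure_density) auto
      qed
      show "cis \<in> density Q (\<lambda>t. ennreal (M' * \<kappa> t)) \<rightarrow>\<^sub>M restrict_space borel (sphere 0 1)"
        by (rule cis_measurable_sphere) simp
    qed
    fix \<phi> :: "complex \<Rightarrow> complex" assume \<phi>: "continuous_on (sphere 0 1) \<phi>"
    define \<psi> where "\<psi> t = \<kappa> t *\<^sub>R \<phi> (cis t)" for t
    have cont: "isCont \<psi> t" for t
      unfolding \<psi>_def[abs_def] \<kappa>_def by (rule isCont_circle_cutoff[OF \<phi>])
    have [measurable]: "\<psi> \<in> borel_measurable borel"
      by (intro borel_measurable_continuous_onI continuous_at_imp_continuous_on) (use cont in auto)
    have "compact (\<phi> ` sphere 0 1)" by (rule compact_continuous_image[OF \<phi> compact_sphere])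
    from compact_imp_bounded[OF this]
    obtain B where B: "\<And>\<zeta>. \<zeta> \<in> sphere 0 1 \<Longrightarrow> norm (\<phi> \<zeta>) \<le> B"
      unfolding bounded_iff Set.ball_simps(9) by blast
    have bdd: "norm (\<psi> t) \<le> B" for t
    proof -
      have "norm (\<psi> t) \<le> 1 * norm (\<phi> (cis t))"
        unfolding \<psi>_def norm_scaleR using \<kappa> by (intro mult_right_mono) auto
      also have "\<dots> \<le> B" using B[of "cis t"] by simp
      finally show ?thesis .
    qed
    have lim: "(\<lambda>n. M' *\<^sub>R (\<integral>t. \<psi> t \<partial>P (k n))) \<longlonglongrightarrow> M' *\<^sub>R (\<integral>t. \<psi> t \<partial>Q)"
      by (intro tendsto_intros weak_conv_imp_integral_bdd_continuous_conv[OF dist Q conv cont bdd])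
    have \<phi>m: "\<phi> \<in> borel_measurable (restrict_space borel (sphere 0 1))"
      by (rule borel_measurable_continuous_on_restrict[OF \<phi>])
    have eq1: "M' *\<^sub>R (\<integral>t. \<psi> t \<partial>P n) = (\<integral>\<zeta>. of_real (W n \<zeta>) * \<phi> \<zeta> \<partial>circle_measure)" for n
    proof -
      have "(\<integral>\<zeta>. of_real (W n \<zeta>) * \<phi> \<zeta> \<partial>circle_measure) = (\<integral>t. v n t *\<^sub>R \<phi> (cis t) \<partial>lborel)"
        using meas[of n] borel_measurable_circle_continuous[OF \<phi>]
        by (subst integral_circle_measure(1)) (auto simp: v_def scaleR_conv_of_real mult_ac)
      \<comment> \<open>The integrands agree pointwise: \<kappa> is 1 where \<open>v n\<close> lives
        and 0 where the auxiliary mass sits.\<close>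
      also have "\<dots> = (\<integral>t. M' *\<^sub>R (d n t *\<^sub>R \<psi> t) \<partial>lborel)"
      proof (intro Bochner_Integration.integral_cong refl)
        fix t :: real
        consider "t \<in> {0..2*pi}" | "t \<in> {10..11}" | "t \<notin> {0..2*pi}" "t \<notin> {10..11}" by blast
        then show "v n t *\<^sub>R \<phi> (cis t) = M' *\<^sub>R (d n t *\<^sub>R \<psi> t)"
        proof cases
          case 1
          then have "t \<le> 7" using pi_less_4 pi_approx by auto
          then have "\<kappa> t = 1" "t \<notin> {10..11}" by (auto simp: \<kappa>_def)
          then show ?thesis using M' by (simp add: d_def \<psi>_def)
        next
          case 2
          then have "\<kappa> t = 0" "t \<notin> {0..2*pi}" using pi_less_4 by (auto simp: \<kappa>_def)
          then show ?thesis by (simp add: v_def \<psi>_def)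
        next
          case 3
          then show ?thesis by (simp add: v_def d_def)
        qed
      qed
      also have "\<dots> = M' *\<^sub>R (\<integral>t. d n t *\<^sub>R \<psi> t \<partial>lborel)" by (rule integral_scaleR_right)
      also have "(\<integral>t. d n t *\<^sub>R \<psi> t \<partial>lborel) = (\<integral>t. \<psi> t \<partial>P n)"
        unfolding P_def using d0 by (intro integral_density[symmetric]) auto
      finally show ?thesis by simp
    qed
    have eq2: "M' *\<^sub>R (\<integral>t. \<psi> t \<partial>Q) = (\<integral>\<zeta>. \<phi> \<zeta> \<partial>\<sigma>)"
    proof -
      have m: "(\<lambda>t. \<phi> (cis t)) \<in> borel_measurable Q"
        using measurable_compose[OF cis_measurable_sphere \<phi>m, of Q] by simp
      have "(\<integral>\<zeta>. \<phi> \<zeta> \<partial>\<sigma>) = (\<integral>t. \<phi> (cis t) \<partial>density Q (\<lambda>t. ennreal (M' * \<kappa> t)))"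
        unfolding \<sigma>_def by (rule integral_distr[OF cis_measurable_sphere \<phi>m]) simp
      also have "\<dots> = (\<integral>t. (M' * \<kappa> t) *\<^sub>R \<phi> (cis t) \<partial>Q)"
        using m M' \<kappa> by (intro integral_density) auto
      also have "\<dots> = (\<integral>t. M' *\<^sub>R \<psi> t \<partial>Q)" by (simp add: \<psi>_def)
      finally show ?thesis by simp
    qed
    show "(\<lambda>n. \<integral>\<zeta>. of_real (W (k n) \<zeta>) * \<phi> \<zeta> \<partial>circle_measure) \<longlonglongrightarrow> (\<integral>\<zeta>. \<phi> \<zeta> \<partial>\<sigma>)"
      using lim unfolding eq1 eq2 .
  qed
qed

text \<open>The real measure is encoded as the difference of the finite measures
  \<open>\<mu>1\<close> and \<open>\<mu>2\<close>; its total variation is at most the sum of their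
  masses, so bounding that sum suffices. The constant is 3, the coefficient of the logarithm in
  \<open>\<Phi>\<^sub>R\<close>.\<close>

theorem mainTheorem2:
  shows "\<exists>C::real>0. \<forall>(f::complex \<Rightarrow> complex) (g::complex \<Rightarrow> complex).
    f holomorphic_on ball 0 1 \<and>
    g \<in> borel_measurable circle_measure \<and>
    (AE \<zeta> in circle_measure. nontangential_limit f \<zeta> (g \<zeta>)) \<and>
    smirnov f g \<and>
    integrable circle_measure (\<lambda>\<zeta>. Re (g \<zeta>)) \<and> Im (f 0) = 0 \<and>
    tail_liminf g < \<infinity>
    \<longrightarrow>
    (\<exists>\<mu>1 \<mu>2 :: complex measure.
       sets \<mu>1 = sets circle_measure \<and> sets \<mu>2 = sets circle_measure \<and>
       finite_measure \<mu>1 \<and> finite_measure \<mu>2 \<and>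
       (\<forall>z\<in>ball 0 1. f z = (\<integral>\<zeta>. (\<zeta> + z) / (\<zeta> - z) \<partial>\<mu>1) - (\<integral>\<zeta>. (\<zeta> + z) / (\<zeta> - z) \<partial>\<mu>2)) \<and>
       measure \<mu>1 (space \<mu>1) + measure \<mu>2 (space \<mu>2)
         \<le> (\<integral>\<zeta>. \<bar>Re (g \<zeta>)\<bar> \<partial>circle_measure) + C * enn2real (tail_liminf g))"
proof (intro exI[of _ 3] conjI allI impI)
  fix f g :: "complex \<Rightarrow> complex"
  assume "f holomorphic_on ball 0 1 \<and>
    g \<in> borel_measurable circle_measure \<and>
    (AE \<zeta> in circle_measure. nontangential_limit f \<zeta> (g \<zeta>)) \<and>
    smirnov f g \<and>
    integrable circle_measure (\<lambda>\<zeta>. Re (g \<zeta>)) \<and> Im (f 0) = 0 \<and>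
    tail_liminf g < \<infinity>"
  then have f: "f holomorphic_on ball 0 1" and f0: "Im (f 0) = 0"
    and mean_le: "\<And>r. 0 \<le> r \<Longrightarrow> r < 1 \<Longrightarrow> (\<integral>\<zeta>. \<bar>Re (f (of_real r * \<zeta>))\<bar> \<partial>circle_measure)
      \<le> (\<integral>\<zeta>. \<bar>Re (g \<zeta>)\<bar> \<partial>circle_measure) + 3 * enn2real (tail_liminf g)"
    using circle_mean_abs_Re_le[of f g] by blast+
  define M where "M = (\<integral>\<zeta>. \<bar>Re (g \<zeta>)\<bar> \<partial>circle_measure) + 3 * enn2real (tail_liminf g)"
  define s where "s n = 1 - inverse (real (Suc n))" for n
  have s: "0 \<le> s n" "s n < 1" for n
    by (simp_all add: s_def inverse_le_1_iff)
  have slim: "s \<longlonglongrightarrow> 1"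
    unfolding s_def[abs_def] using tendsto_diff[OF tendsto_const LIMSEQ_inverse_real_of_nat, of 1] by simp
  define u where "u n \<zeta> = Re (f (of_real (s n) * \<zeta>))" for n \<zeta>
  have u: "continuous_on (sphere 0 1) (u n)" for n
    unfolding u_def[abs_def]
    by (intro continuous_intros continuous_on_subset[OF continuous_on_dilation[OF f s]]) auto
  have abs_le: "(\<integral>\<zeta>. \<bar>u n \<zeta>\<bar> \<partial>circle_measure) \<le> M" for n
    unfolding u_def M_def by (rule mean_le[OF s])
  \<comment> \<open>The compactness lemma concerns nonnegative densities, so the positive and
    negative parts of \<open>u n\<close> are treated separately.\<close>
  define U where "U n \<zeta> = max 0 (u n \<zeta>)" for n \<zeta>
  define V where "V n \<zeta> = max 0 (- u n \<zeta>)" for n \<zeta>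
  have contU: "continuous_on (sphere 0 1) (U n)" and contV: "continuous_on (sphere 0 1) (V n)" for n
    unfolding U_def[abs_def] V_def[abs_def] by (intro continuous_intros u)+
  have intU: "integrable circle_measure (U n)" and intV: "integrable circle_measure (V n)"
    and intu: "integrable circle_measure (\<lambda>\<zeta>. \<bar>u n \<zeta>\<bar>)" for n
    by (intro integrable_circle_continuous contU contV continuous_intros u)+
  have U_le: "(\<integral>\<zeta>. U n \<zeta> \<partial>circle_measure) \<le> M" for n
    by (rule order_trans[OF integral_mono[OF intU intu[of n]] abs_le[of n]]) (simp add: U_def)
  have V_le: "(\<integral>\<zeta>. V n \<zeta> \<partial>circle_measure) \<le> M" for n
    by (rule order_trans[OF integral_mono[OF intV intu[of n]] abs_le[of n]]) (simp add: V_def)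
  have nonneg: "0 \<le> U n \<zeta>" "0 \<le> V n \<zeta>" for n \<zeta> by (auto simp: U_def V_def)
  obtain k1 \<mu>1 where k1: "strict_mono (k1 :: nat \<Rightarrow> nat)"
    and \<mu>1: "sets \<mu>1 = sets circle_measure" "finite_measure \<mu>1"
    and lim1: "\<And>\<phi> :: complex \<Rightarrow> complex. continuous_on (sphere 0 1) \<phi> \<Longrightarrow>
       (\<lambda>n. \<integral>\<zeta>. of_real (U (k1 n) \<zeta>) * \<phi> \<zeta> \<partial>circle_measure) \<longlonglongrightarrow> (\<integral>\<zeta>. \<phi> \<zeta> \<partial>\<mu>1)"
    using circle_densities_weakly_compact[of U M, OF intU nonneg(1) U_le] by blast
  \<comment> \<open>The second extraction is made along \<open>k1\<close>, so that both parts
    converge along the common subsequence \<open>k\<close>.\<close>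
  obtain k2 \<mu>2 where k2: "strict_mono (k2 :: nat \<Rightarrow> nat)"
    and \<mu>2: "sets \<mu>2 = sets circle_measure" "finite_measure \<mu>2"
    and lim2: "\<And>\<phi> :: complex \<Rightarrow> complex. continuous_on (sphere 0 1) \<phi> \<Longrightarrow>
       (\<lambda>n. \<integral>\<zeta>. of_real (V (k1 (k2 n)) \<zeta>) * \<phi> \<zeta> \<partial>circle_measure) \<longlonglongrightarrow> (\<integral>\<zeta>. \<phi> \<zeta> \<partial>\<mu>2)"
    using circle_densities_weakly_compact[of "\<lambda>n. V (k1 n)" M, OF intV nonneg(2) V_le] by blast
  define k where "k n = k1 (k2 n)" for n
  have k: "strict_mono k" unfolding k_def using strict_mono_o[OF k1 k2] by (simp add: o_def)
  have limU: "(\<lambda>n. \<integral>\<zeta>. of_real (U (k n) \<zeta>) * \<phi> \<zeta> \<partial>circle_measure) \<longlonglongrightarrow> (\<integral>\<zeta>. \<phi> \<zeta> \<partial>\<mu>1)"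
    if "continuous_on (sphere 0 1) \<phi>" for \<phi> :: "complex \<Rightarrow> complex"
    using LIMSEQ_subseq_LIMSEQ[OF lim1[OF that] k2] by (simp add: o_def k_def)
  have limV: "(\<lambda>n. \<integral>\<zeta>. of_real (V (k n) \<zeta>) * \<phi> \<zeta> \<partial>circle_measure) \<longlonglongrightarrow> (\<integral>\<zeta>. \<phi> \<zeta> \<partial>\<mu>2)"
    if "continuous_on (sphere 0 1) \<phi>" for \<phi> :: "complex \<Rightarrow> complex"
    using lim2[OF that] by (simp add: k_def)
  have repr: "f z = (\<integral>\<zeta>. (\<zeta> + z) / (\<zeta> - z) \<partial>\<mu>1) - (\<integral>\<zeta>. (\<zeta> + z) / (\<zeta> - z) \<partial>\<mu>2)"
    if z: "z \<in> ball 0 1" for z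
  proof (rule LIMSEQ_unique)
    let ?K = "\<lambda>\<zeta>. (\<zeta> + z) / (\<zeta> - z)"
    have K: "continuous_on (sphere 0 1) ?K"
      using z by (intro continuous_intros) auto
    \<comment> \<open>Schwarz's formula for the dilated function; its additive imaginary constant
      vanishes because \<open>Im (f 0) = 0\<close>. Both sides then pass to the limit, the left by
      weak convergence and the right by continuity of \<open>f\<close> at \<open>z\<close>.\<close>
    have eq: "(\<integral>\<zeta>. of_real (U n \<zeta>) * ?K \<zeta> \<partial>circle_measure) - (\<integral>\<zeta>. of_real (V n \<zeta>) * ?K \<zeta> \<partial>circle_measure)
        = f (of_real (s n) * z)" for n
    proof -
      have "(\<integral>\<zeta>. of_real (U n \<zeta>) * ?K \<zeta> \<partial>circle_measure) - (\<integral>\<zeta>. of_real (V n \<zeta>) * ?K \<zeta> \<partial>circle_measure)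
          = (\<integral>\<zeta>. of_real (U n \<zeta>) * ?K \<zeta> - of_real (V n \<zeta>) * ?K \<zeta> \<partial>circle_measure)"
        by (intro Bochner_Integration.integral_diff[symmetric] integrable_circle_continuous
            continuous_on_mult continuous_on_of_real contU contV K)
      also have "\<dots> = (\<integral>\<zeta>. of_real (Re (f (of_real (s n) * \<zeta>))) * ?K \<zeta> \<partial>circle_measure)"
      proof (intro Bochner_Integration.integral_cong refl)
        fix \<zeta>
        have "U n \<zeta> - V n \<zeta> = u n \<zeta>" by (auto simp: U_def V_def)
        then show "of_real (U n \<zeta>) * ?K \<zeta> - of_real (V n \<zeta>) * ?K \<zeta>
            = of_real (Re (f (of_real (s n) * \<zeta>))) * ?K \<zeta>"
          unfolding left_diff_distrib[symmetric] of_real_diff[symmetric] by (simp only: u_def)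
      qed
      also have "\<dots> = f (of_real (s n) * z)"
        using Schwarz_integral_formula[OF continuous_on_dilation[OF f s]
            holomorphic_on_dilation[OF f s], of z n] z f0 by simp
      finally show ?thesis .
    qed
    show "(\<lambda>n. f (of_real (s (k n)) * z)) \<longlonglongrightarrow> (\<integral>\<zeta>. ?K \<zeta> \<partial>\<mu>1) - (\<integral>\<zeta>. ?K \<zeta> \<partial>\<mu>2)"
      unfolding eq[symmetric] by (intro tendsto_diff limU limV K)
    have "(\<lambda>n. s (k n)) \<longlonglongrightarrow> 1"
      using LIMSEQ_subseq_LIMSEQ[OF slim k] by (simp add: o_def)
    then have "(\<lambda>n. of_real (s (k n)) * z) \<longlonglongrightarrow> of_real 1 * z"
      by (intro tendsto_intros)
    then show "(\<lambda>n. f (of_real (s (k n)) * z)) \<longlonglongrightarrow> f z"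
      using holomorphic_on_imp_continuous_on[OF f] z
      by (intro isCont_tendsto_compose[of z f]) (auto simp: continuous_on_eq_continuous_at)
  qed
  have total: "measure \<mu>1 (space \<mu>1) + measure \<mu>2 (space \<mu>2) \<le> M"
  proof (rule LIMSEQ_le_const2)
    \<comment> \<open>Testing with the constant 1 gives the masses of the limits. Adding the two
      parts before estimating, with \<open>U + V = \<bar>u\<bar>\<close>, yields the bound
      \<open>M\<close>; separate estimates would give only \<open>2 * M\<close>.\<close>
    have "(\<lambda>n. Re (\<integral>\<zeta>. of_real (U (k n) \<zeta>) * 1 \<partial>circle_measure)
             + Re (\<integral>\<zeta>. of_real (V (k n) \<zeta>) * 1 \<partial>circle_measure))
        \<longlonglongrightarrow> Re (\<integral>\<zeta>. 1 \<partial>\<mu>1) + Re (\<integral>\<zeta>. 1 \<partial>\<mu>2)"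
      by (intro tendsto_intros limU limV continuous_intros)
    also have "(\<lambda>n. Re (\<integral>\<zeta>. of_real (U (k n) \<zeta>) * 1 \<partial>circle_measure)
             + Re (\<integral>\<zeta>. of_real (V (k n) \<zeta>) * 1 \<partial>circle_measure))
        = (\<lambda>n. \<integral>\<zeta>. \<bar>u (k n) \<zeta>\<bar> \<partial>circle_measure)"
    proof
      fix n
      have "(\<integral>\<zeta>. U (k n) \<zeta> \<partial>circle_measure) + (\<integral>\<zeta>. V (k n) \<zeta> \<partial>circle_measure)
          = (\<integral>\<zeta>. U (k n) \<zeta> + V (k n) \<zeta> \<partial>circle_measure)"
        by (intro Bochner_Integration.integral_add[symmetric] intU intV)
      also have "\<dots> = (\<integral>\<zeta>. \<bar>u (k n) \<zeta>\<bar> \<partial>circle_measure)"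
        by (intro Bochner_Integration.integral_cong) (auto simp: U_def V_def)
      finally show "Re (\<integral>\<zeta>. of_real (U (k n) \<zeta>) * 1 \<partial>circle_measure)
             + Re (\<integral>\<zeta>. of_real (V (k n) \<zeta>) * 1 \<partial>circle_measure)
           = (\<integral>\<zeta>. \<bar>u (k n) \<zeta>\<bar> \<partial>circle_measure)" by simp
    qed
    also have "Re (\<integral>\<zeta>. 1 \<partial>\<mu>1) + Re (\<integral>\<zeta>. 1 \<partial>\<mu>2) = measure \<mu>1 (space \<mu>1) + measure \<mu>2 (space \<mu>2)"
      by simp
    finally show "(\<lambda>n. \<integral>\<zeta>. \<bar>u (k n) \<zeta>\<bar> \<partial>circle_measure) \<longlonglongrightarrow> measure \<mu>1 (space \<mu>1) + measure \<mu>2 (space \<mu>2)" .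
  qed (use abs_le in blast)
  show "\<exists>\<mu>1 \<mu>2 :: complex measure.
       sets \<mu>1 = sets circle_measure \<and> sets \<mu>2 = sets circle_measure \<and>
       finite_measure \<mu>1 \<and> finite_measure \<mu>2 \<and>
       (\<forall>z\<in>ball 0 1. f z = (\<integral>\<zeta>. (\<zeta> + z) / (\<zeta> - z) \<partial>\<mu>1) - (\<integral>\<zeta>. (\<zeta> + z) / (\<zeta> - z) \<partial>\<mu>2)) \<and>
       measure \<mu>1 (space \<mu>1) + measure \<mu>2 (space \<mu>2)
         \<le> (\<integral>\<zeta>. \<bar>Re (g \<zeta>)\<bar> \<partial>circle_measure) + 3 * enn2real (tail_liminf g)"
    using \<mu>1 \<mu>2 repr total unfolding M_def by blast
qed simp

end
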